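(* Let $\mathbf d$ be a non-zero c.e. Turing degree. Then there exists a total function $f:\omega\to\omega$ of Turing degree $\mathbf d$ such that (the PR-degree of) $f$ is low for punctual isomorphism.
   Context: A punctual structure is a structure with domain $\omega$ whose operations and relations are uniformly primitive recursive. Two punctual structures are punctually isomorphic if there is an isomorphism $h$ between them such that both $h$ and $h^{-1}$ are primitive recursive. For total functions $f,g:\omega\to\omega$, write $f\leq_{PR} g$ if there is a primitive recursive scheme $\Psi$ (a primitive recursive definition which may additionally use the oracle function as a basic function) with $\Psi^{g}=f$. Write $f\equiv_{PR}g$ if $f\leq_{PR}g$ and $g\leq_{PR}f$. The $\equiv_{PR}$-classes are the PR-degrees, ordered by $\leq_{PR}$. The join $f\oplus g$ is defined by $(f\oplus g)(2n)=f(n)$, $(f\oplus g)(2n+1)=g(n)$. A PR-degree $\mathbf a$ is low for punctual isomorphism if for all punctual structures $A\cong B$: whenever there is an isomorphism $h:A\to B$ with $h\oplus h^{-1}\leq_{PR}\mathbf a$, then $A$ and $B$ are punctually isomorphic. *)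

theory Defs
  imports Main "HOL-Library.Nat_Bijection"
begin

section \<open>Recursion schemes relative to a total function\<close>

text \<open>
  Kleene's schemes, extended by the basic unary function \<open>Query\<close>, which stands for the
  total function \<open>g\<close> relative to which a scheme is evaluated.  Primitive recursive schemes
  are those without \<open>Mu\<close>; unrelativised ones are those without \<open>Query\<close>.
\<close>

datatype scheme =
    Zero
  | Succ
  | Proj nat
  | Query
  | Comp scheme "scheme list"
  | PrimRec scheme scheme
  | Mu scheme

text \<open>\<open>has_arity n p\<close>: the scheme \<open>p\<close> is a well-formed definition of an \<open>n\<close>-ary function.\<close>

fun has_arity :: "nat \<Rightarrow> scheme \<Rightarrow> bool" where
  "has_arity n Zero \<longleftrightarrow> True"
| "has_arity n Succ \<longleftrightarrow> n = 1"
| "has_arity n (Proj i) \<longleftrightarrow> i < n"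
| "has_arity n Query \<longleftrightarrow> n = 1"
| "has_arity n (Comp p qs) \<longleftrightarrow> has_arity (length qs) p \<and> (\<forall>q\<in>set qs. has_arity n q)"
| "has_arity n (PrimRec p q) \<longleftrightarrow> n > 0 \<and> has_arity (n - 1) p \<and> has_arity (n + 1) q"
| "has_arity n (Mu p) \<longleftrightarrow> has_arity (n + 1) p"

fun mu_free :: "scheme \<Rightarrow> bool" where
  "mu_free (Comp p qs) \<longleftrightarrow> mu_free p \<and> (\<forall>q\<in>set qs. mu_free q)"
| "mu_free (PrimRec p q) \<longleftrightarrow> mu_free p \<and> mu_free q"
| "mu_free (Mu p) \<longleftrightarrow> False"
| "mu_free _ \<longleftrightarrow> True"

fun query_free :: "scheme \<Rightarrow> bool" where
  "query_free (Comp p qs) \<longleftrightarrow> query_free p \<and> (\<forall>q\<in>set qs. query_free q)"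
| "query_free (PrimRec p q) \<longleftrightarrow> query_free p \<and> query_free q"
| "query_free (Mu p) \<longleftrightarrow> query_free p"
| "query_free Query \<longleftrightarrow> False"
| "query_free _ \<longleftrightarrow> True"

text \<open>
  Unbounded search for the first zero of a partial function; it diverges if \<open>F\<close> is undefined
  somewhere before its first zero.
\<close>

definition mu_search :: "(nat \<Rightarrow> nat option) \<Rightarrow> nat option" where
  "mu_search F =
     (if \<exists>n. F n = Some 0 \<and> (\<forall>m<n. F m \<noteq> None)
      then Some (LEAST n. F n = Some 0) else None)"

text \<open>
  \<open>eval g p xs\<close> is the value of the scheme \<open>p\<close> relative to \<open>g\<close> at \<open>xs\<close>, and \<open>None\<close> if it
  diverges.  It is meaningful only if \<open>has_arity (length xs) p\<close>.  The recursion variable of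
  \<open>PrimRec\<close> and the search variable of \<open>Mu\<close> come first in the argument list.
\<close>

fun eval :: "(nat \<Rightarrow> nat) \<Rightarrow> scheme \<Rightarrow> nat list \<Rightarrow> nat option" where
  "eval g Zero xs = Some 0"
| "eval g Succ xs = Some (Suc (hd xs))"
| "eval g (Proj i) xs = Some (xs ! i)"
| "eval g Query xs = Some (g (hd xs))"
| "eval g (Comp p qs) xs = Option.bind (those (map (\<lambda>q. eval g q xs) qs)) (eval g p)"
| "eval g (PrimRec p q) xs =
     rec_nat (eval g p (tl xs))
       (\<lambda>m r. Option.bind r (\<lambda>y. eval g q (m # y # tl xs))) (hd xs)"
| "eval g (Mu p) xs = mu_search (\<lambda>n. eval g p (n # xs))"


section \<open>Computability\<close>

text \<open>For query-free schemes the first argument of \<open>eval\<close> is irrelevant; it is set to \<open>\<lambda>_. 0\<close>.\<close>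

definition prim_recursive :: "nat \<Rightarrow> (nat list \<Rightarrow> nat) \<Rightarrow> bool" where
  "prim_recursive n F \<longleftrightarrow>
     (\<exists>p. has_arity n p \<and> mu_free p \<and> query_free p \<and>
          (\<forall>xs. length xs = n \<longrightarrow> eval (\<lambda>_. 0) p xs = Some (F xs)))"

abbreviation prim_recursive1 :: "(nat \<Rightarrow> nat) \<Rightarrow> bool" where
  "prim_recursive1 f \<equiv> prim_recursive 1 (\<lambda>xs. f (hd xs))"

definition computable :: "(nat \<Rightarrow> nat) \<Rightarrow> bool" where
  "computable f \<longleftrightarrow>
     (\<exists>p. has_arity 1 p \<and> query_free p \<and> (\<forall>x. eval (\<lambda>_. 0) p [x] = Some (f x)))"

definition ce_set :: "nat set \<Rightarrow> bool" where
  "ce_set W \<longleftrightarrow>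
     (\<exists>p. has_arity 1 p \<and> query_free p \<and> W = {x. eval (\<lambda>_. 0) p [x] \<noteq> None})"

definition char_fun :: "nat set \<Rightarrow> nat \<Rightarrow> nat" where
  "char_fun W x = of_bool (x \<in> W)"


section \<open>Turing degrees and PR-degrees\<close>

definition turing_le :: "(nat \<Rightarrow> nat) \<Rightarrow> (nat \<Rightarrow> nat) \<Rightarrow> bool" (infix "\<le>\<^sub>T" 50) where
  "f \<le>\<^sub>T g \<longleftrightarrow> (\<exists>p. has_arity 1 p \<and> (\<forall>x. eval g p [x] = Some (f x)))"

definition pr_le :: "(nat \<Rightarrow> nat) \<Rightarrow> (nat \<Rightarrow> nat) \<Rightarrow> bool" (infix "\<le>\<^bsub>PR\<^esub>" 50) where
  "f \<le>\<^bsub>PR\<^esub> g \<longleftrightarrow> (\<exists>p. has_arity 1 p \<and> mu_free p \<and> (\<forall>x. eval g p [x] = Some (f x)))"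

definition turing_degree :: "(nat \<Rightarrow> nat) \<Rightarrow> (nat \<Rightarrow> nat) set" where
  "turing_degree f = {g. g \<le>\<^sub>T f \<and> f \<le>\<^sub>T g}"

definition pr_degree :: "(nat \<Rightarrow> nat) \<Rightarrow> (nat \<Rightarrow> nat) set" where
  "pr_degree f = {g. g \<le>\<^bsub>PR\<^esub> f \<and> f \<le>\<^bsub>PR\<^esub> g}"

definition zero_turing_degree :: "(nat \<Rightarrow> nat) set" where
  "zero_turing_degree = {f. computable f}"

definition ce_turing_degree :: "(nat \<Rightarrow> nat) set \<Rightarrow> bool" where
  "ce_turing_degree d \<longleftrightarrow> (\<exists>W. ce_set W \<and> d = turing_degree (char_fun W))"

definition pr_le_degree :: "(nat \<Rightarrow> nat) \<Rightarrow> (nat \<Rightarrow> nat) set \<Rightarrow> bool" where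
  "pr_le_degree f a \<longleftrightarrow> (\<exists>g\<in>a. f \<le>\<^bsub>PR\<^esub> g)"

definition join :: "(nat \<Rightarrow> nat) \<Rightarrow> (nat \<Rightarrow> nat) \<Rightarrow> nat \<Rightarrow> nat" (infixl "\<oplus>" 65) where
  "(f \<oplus> g) n = (if even n then f (n div 2) else g (n div 2))"


section \<open>Punctual structures\<close>

text \<open>
  A language consists of two countable, possibly finite or empty, families of symbols named by
  natural numbers; constants are function symbols of arity 0.  Structures have domain \<open>\<omega>\<close>,
  that is, the whole type \<^typ>\<open>nat\<close>; only the interpretations of symbols of the language at
  tuples of the right length matter.
\<close>

record language =
  fun_syms :: "nat set"
  fun_ar :: "nat \<Rightarrow> nat"
  rel_syms :: "nat set"
  rel_ar :: "nat \<Rightarrow> nat"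

record nat_structure =
  fun_int :: "nat \<Rightarrow> nat list \<Rightarrow> nat"
  rel_int :: "nat \<Rightarrow> nat list \<Rightarrow> bool"

definition prim_recursive_language :: "language \<Rightarrow> bool" where
  "prim_recursive_language L \<longleftrightarrow>
     prim_recursive1 (char_fun (fun_syms L)) \<and> prim_recursive1 (fun_ar L) \<and>
     prim_recursive1 (char_fun (rel_syms L)) \<and> prim_recursive1 (rel_ar L)"

text \<open>
  Uniformity: a single primitive recursive function evaluates all operations, and a single one
  decides all relations, given the symbol and the code of the argument tuple.
\<close>

definition punctual :: "language \<Rightarrow> nat_structure \<Rightarrow> bool" where
  "punctual L A \<longleftrightarrow>
     prim_recursive_language L \<and>
     (\<exists>F. prim_recursive 2 F \<and>
        (\<forall>i\<in>fun_syms L. \<forall>xs. length xs = fun_ar L i \<longrightarrow>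
           F [i, list_encode xs] = fun_int A i xs)) \<and>
     (\<exists>R. prim_recursive 2 R \<and>
        (\<forall>i\<in>rel_syms L. \<forall>xs. length xs = rel_ar L i \<longrightarrow>
           R [i, list_encode xs] = of_bool (rel_int A i xs)))"

definition isomorphism :: "language \<Rightarrow> nat_structure \<Rightarrow> nat_structure \<Rightarrow> (nat \<Rightarrow> nat) \<Rightarrow> bool" where
  "isomorphism L A B h \<longleftrightarrow>
     bij h \<and>
     (\<forall>i\<in>fun_syms L. \<forall>xs. length xs = fun_ar L i \<longrightarrow>
        h (fun_int A i xs) = fun_int B i (map h xs)) \<and>
     (\<forall>i\<in>rel_syms L. \<forall>xs. length xs = rel_ar L i \<longrightarrow>
        (rel_int A i xs \<longleftrightarrow> rel_int B i (map h xs)))"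

definition isomorphic :: "language \<Rightarrow> nat_structure \<Rightarrow> nat_structure \<Rightarrow> bool" where
  "isomorphic L A B \<longleftrightarrow> (\<exists>h. isomorphism L A B h)"

definition punctually_isomorphic :: "language \<Rightarrow> nat_structure \<Rightarrow> nat_structure \<Rightarrow> bool" where
  "punctually_isomorphic L A B \<longleftrightarrow>
     (\<exists>h. isomorphism L A B h \<and> prim_recursive1 h \<and> prim_recursive1 (inv h))"

definition low_for_punctual_isomorphism :: "(nat \<Rightarrow> nat) set \<Rightarrow> bool" where
  "low_for_punctual_isomorphism a \<longleftrightarrow>
     (\<forall>L A B. punctual L A \<longrightarrow> punctual L B \<longrightarrow> isomorphic L A B \<longrightarrow>
        (\<exists>h. isomorphism L A B h \<and> pr_le_degree (h \<oplus> inv h) a) \<longrightarrow>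
        punctually_isomorphic L A B)"

end

(* Let W be c.e. and not computable, of degree d.  Take f to be a counter that waits at k until
   the enumeration of W has settled k.  Then f and W are Turing equivalent, and f is constant on
   long stretches.  If h and its inverse are obtained from f by primitive recursive schemes, then
   "these schemes, run on the oracle X, give an isomorphism and its inverse" fails, whenever it
   fails, at a finite stage that depends on a finite part of X.  Test it on all primitive
   recursive X that follow some finite counter and then stop forever.  If some X passes, then A and
   B are punctually isomorphic.  If every X fails, the length of oracle at which it does so is a
   computable function of X, and f, which passes, must leave the constant stretch within that
   length; this gives a computable bound on the time f needs to reach k, so W is computable. *)

theory Submission
  imports Defs
begin

section \<open>Schemes\<close>

text \<open>The obstacle is uniformity. The counter that \<open>f\<close> really follows up to a
  given stage has a code that depends on \<open>W\<close>, so no computation can pick it out. Its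
  code does lie below a known power of two, and summing the rejection lengths over all codes of that
  size bounds the right one without identifying it. Starting from stage 0 and repeating this step
  gives a computable sequence of stages along which \<open>f\<close> strictly increases. Two uniform
  facts support the sum: the index of a finite counter can be made an ordinary argument of a scheme
  in place of the oracle, and the length of oracle consulted by a scheme is itself a primitive
  recursive functional of that oracle. Failure shows at a finite stage because the inverse is part
  of the data. Surjectivity alone asks for a preimage of each element, which is an unbounded search;
  with a candidate inverse at hand it becomes an equation tested pointwise. Hence the role of
  \<open>h \<oplus> inv h\<close> in the notion of lowness.\<close>

fun subst_query :: "scheme \<Rightarrow> scheme \<Rightarrow> scheme" where
  "subst_query r Query = r"
| "subst_query r (Comp p qs) = Comp (subst_query r p) (map (subst_query r) qs)"
| "subst_query r (PrimRec p q) = PrimRec (subst_query r p) (subst_query r q)"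
| "subst_query r (Mu p) = Mu (subst_query r p)"
| "subst_query r p = p"

lemma has_arity_subst_query:
  "has_arity 1 r \<Longrightarrow> has_arity n p \<Longrightarrow> has_arity n (subst_query r p)"
  by (induction p arbitrary: n) auto

lemma mu_free_subst_query: "mu_free r \<Longrightarrow> mu_free p \<Longrightarrow> mu_free (subst_query r p)"
  by (induction p) auto

lemma query_free_subst_query: "query_free r \<Longrightarrow> query_free (subst_query r p)"
  by (induction p) auto

lemma length_those: "those ys = Some zs \<Longrightarrow> length zs = length ys"
  by (induction ys arbitrary: zs) (auto split: option.splits)

lemma those_map_Some: "(\<And>x. x \<in> set xs \<Longrightarrow> f x = Some (h x)) \<Longrightarrow> those (map f xs) = Some (map h xs)"
  by (induction xs) auto

text \<open>The scheme \<open>r\<close> is specified at one-element lists only; the arity condition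
  guarantees that \<open>Query\<close> is never met at any other list.\<close>

lemma eval_subst_query:
  assumes "\<And>x. eval g' r [x] = Some (g x)" and "has_arity (length xs) p"
  shows "eval g' (subst_query r p) xs = eval g p xs"
  using assms(2)
proof (induction p arbitrary: xs)
  case Query
  then obtain x where "xs = [x]" by (auto simp: length_Suc_conv)
  then show ?case using assms(1) by simp
next
  case (Comp p qs)
  have eq: "map ((\<lambda>q. eval g' q xs) \<circ> subst_query r) qs = map (\<lambda>q. eval g q xs) qs"
    using Comp by auto
  show ?case
    using Comp length_those[of "map (\<lambda>q. eval g q xs) qs"] unfolding subst_query.simps eval.simps map_map eq
    by (cases "those (map (\<lambda>q. eval g q xs) qs)") auto
next
  case (PrimRec p q)
  have *: "eval g' (subst_query r q) (m # y # tl xs) = eval g q (m # y # tl xs)" for m y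
    by (rule PrimRec.IH(2)) (use PrimRec.prems in auto)
  have **: "eval g' (subst_query r p) (tl xs) = eval g p (tl xs)"
    by (rule PrimRec.IH(1)) (use PrimRec.prems in auto)
  show ?case by (simp add: * **)
next
  case (Mu p)
  have "eval g' (subst_query r p) (m # xs) = eval g p (m # xs)" for m
    by (rule Mu.IH) (use Mu.prems in auto)
  then show ?case by simp
qed auto

lemma eval_query_free: "query_free p \<Longrightarrow> eval g p xs = eval g' p xs"
proof (induction p arbitrary: xs)
  case (Comp p qs)
  have "map (\<lambda>q. eval g q xs) qs = map (\<lambda>q. eval g' q xs) qs"
    using Comp by auto
  moreover have "eval g p = eval g' p"
    using Comp by auto
  ultimately show ?case by (simp only: eval.simps)
next
  case (PrimRec p q)
  have *: "eval g q ys = eval g' q ys" for ys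
    using PrimRec by simp
  have **: "eval g p ys = eval g' p ys" for ys
    using PrimRec by simp
  show ?case by (simp add: * **)
qed auto

text \<open>This licenses \<open>the (eval g p xs)\<close> as the value of a search-free scheme
  throughout.\<close>

lemma eval_mu_free_total:
  "has_arity (length xs) p \<Longrightarrow> mu_free p \<Longrightarrow> \<exists>y. eval g p xs = Some y"
proof (induction p arbitrary: xs)
  case (Comp p qs)
  have "\<forall>q\<in>set qs. eval g q xs = Some (the (eval g q xs))"
    using Comp by fastforce
  then have *: "those (map (\<lambda>q. eval g q xs) qs) = Some (map (\<lambda>q. the (eval g q xs)) qs)"
    by (intro those_map_Some) auto
  show ?case
    unfolding eval.simps * using Comp by simp
next
  case (PrimRec p q)
  have "\<exists>y. rec_nat (eval g p (tl xs))
      (\<lambda>m r. Option.bind r (\<lambda>y. eval g q (m # y # tl xs))) k = Some y" for k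
  proof (induction k)
    case 0
    then show ?case using PrimRec by simp
  next
    case (Suc k)
    then obtain y where "rec_nat (eval g p (tl xs))
      (\<lambda>m r. Option.bind r (\<lambda>y. eval g q (m # y # tl xs))) k = Some y" by blast
    moreover have "\<exists>z. eval g q (k # y # tl xs) = Some z"
      by (rule PrimRec.IH(2)) (use PrimRec.prems in auto)
    ultimately show ?case by simp
  qed
  then show ?case by simp
qed auto


section \<open>Uniformly definable functionals\<close>

text \<open>One predicate covers primitive recursive functionals (\<open>b = False\<close>, \<open>G = UNIV\<close>) and functions
  computable in a single oracle (\<open>b = True\<close>, \<open>G = {g}\<close>), so that closure is proved only once.\<close>

definition definable ::
    "bool \<Rightarrow> (nat \<Rightarrow> nat) set \<Rightarrow> nat \<Rightarrow> ((nat \<Rightarrow> nat) \<Rightarrow> nat list \<Rightarrow> nat) \<Rightarrow> bool" where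
  "definable b G n F \<longleftrightarrow>
     (\<exists>p. has_arity n p \<and> (b \<or> mu_free p) \<and>
       (\<forall>g\<in>G. \<forall>xs. length xs = n \<longrightarrow> eval g p xs = Some (F g xs)))"

abbreviation decidable ::
    "bool \<Rightarrow> (nat \<Rightarrow> nat) set \<Rightarrow> nat \<Rightarrow> ((nat \<Rightarrow> nat) \<Rightarrow> nat list \<Rightarrow> bool) \<Rightarrow> bool" where
  "decidable b G n P \<equiv> definable b G n (\<lambda>g xs. of_bool (P g xs))"

lemma definable_cong:
  assumes "definable b G n F" and "\<And>g xs. g \<in> G \<Longrightarrow> length xs = n \<Longrightarrow> F g xs = F' g xs"
  shows "definable b G n F'"
  using assms unfolding definable_def by metis

lemma definable_mono: "definable False UNIV n F \<Longrightarrow> definable b G n F"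
  unfolding definable_def by auto

lemma definable_eval:
  assumes "has_arity n p" and "mu_free p"
  shows "definable b G n (\<lambda>g xs. the (eval g p xs))"
  unfolding definable_def using assms eval_mu_free_total
  by (metis option.sel)

lemma prim_recursive_definable: "prim_recursive n F \<Longrightarrow> definable b G n (\<lambda>g. F)"
  unfolding definable_def prim_recursive_def by (metis eval_query_free)

text \<open>Transitivity of Turing and of primitive recursive reducibility at once: queries to
  \<open>g\<close> are replaced by the scheme that computes \<open>g\<close> from
  \<open>g'\<close>.\<close>

lemma definable_oracle_subst:
  assumes "definable b {g} n F" and "definable b {g'} 1 (\<lambda>_ xs. g (xs ! 0))"
  shows "definable b {g'} n (\<lambda>_. F g)"
proof -
  obtain p where p: "has_arity n p" "b \<or> mu_free p"
    "\<And>xs. length xs = n \<Longrightarrow> eval g p xs = Some (F g xs)"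
    using assms(1) unfolding definable_def by auto
  obtain r where r: "has_arity 1 r" "b \<or> mu_free r"
    "\<And>xs. length xs = 1 \<Longrightarrow> eval g' r xs = Some (g (xs ! 0))"
    using assms(2) unfolding definable_def by auto
  have "eval g' (subst_query r p) xs = eval g p xs" if "length xs = n" for xs
    by (rule eval_subst_query) (use p r that in auto)
  then show ?thesis
    unfolding definable_def using p r has_arity_subst_query mu_free_subst_query
    by (intro exI[of _ "subst_query r p"]) auto
qed

text \<open>An oracle that can be computed under every oracle is absorbed into the scheme, which
  yields the query-free schemes that \<open>computable\<close> and \<open>prim_recursive\<close> ask
  for.\<close>

lemma definable_query_free:
  assumes "definable b {g} n F" and "definable b UNIV 1 (\<lambda>_ xs. g (xs ! 0))"
  shows "\<exists>p. has_arity n p \<and> (b \<or> mu_free p) \<and> query_free p \<and>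
    (\<forall>xs. length xs = n \<longrightarrow> eval g' p xs = Some (F g xs))"
proof -
  obtain p where p: "has_arity n p" "b \<or> mu_free p"
    "\<And>xs. length xs = n \<Longrightarrow> eval g p xs = Some (F g xs)"
    using assms(1) unfolding definable_def by auto
  obtain r where r: "has_arity 1 r" "b \<or> mu_free r"
    "\<And>xs h. length xs = 1 \<Longrightarrow> eval h r xs = Some (g (xs ! 0))"
    using assms(2) unfolding definable_def by auto
  \<comment> \<open>The scheme \<open>r\<close> may still contain \<open>Query\<close>. Answering
    each query by 0 evaluates it relative to the zero function, under which it computes
    \<open>g\<close> as under any other oracle.\<close>
  let ?r = "subst_query Zero r"
  have r': "eval g' ?r [x] = Some (g x)" for x
    using eval_subst_query[of g' Zero "\<lambda>_. 0" "[x]" r] r by simp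
  have q: "query_free ?r" "has_arity 1 ?r" "b \<or> mu_free ?r"
    using r by (auto intro: query_free_subst_query has_arity_subst_query mu_free_subst_query)
  have "eval g' (subst_query ?r p) xs = eval g p xs" if "length xs = n" for xs
    by (rule eval_subst_query) (use p r' that in auto)
  then show ?thesis
    using p q has_arity_subst_query mu_free_subst_query query_free_subst_query
    by (intro exI[of _ "subst_query ?r p"]) auto
qed

section \<open>Closure under composition, tuples, recursion and search\<close>

lemma definable_comp:
  assumes "definable b G (length Fs) H" and "\<And>F. F \<in> set Fs \<Longrightarrow> definable b G n F"
  shows "definable b G n (\<lambda>g xs. H g (map (\<lambda>F. F g xs) Fs))"
proof -
  obtain p where p: "has_arity (length Fs) p" "b \<or> mu_free p"
    "\<And>g xs. g \<in> G \<Longrightarrow> length xs = length Fs \<Longrightarrow> eval g p xs = Some (H g xs)"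
    using assms(1) unfolding definable_def by auto
  obtain P where P: "\<And>F. F \<in> set Fs \<Longrightarrow> has_arity n (P F) \<and> (b \<or> mu_free (P F)) \<and>
    (\<forall>g\<in>G. \<forall>xs. length xs = n \<longrightarrow> eval g (P F) xs = Some (F g xs))"
    using assms(2) unfolding definable_def by metis
  have "those (map (\<lambda>q. eval g q xs) (map P Fs)) = Some (map (\<lambda>F. F g xs) Fs)"
    if "g \<in> G" "length xs = n" for g xs
    using P that by (simp add: comp_def those_map_Some)
  then show ?thesis
    unfolding definable_def using p P
    by (intro exI[of _ "Comp p (map P Fs)"]) auto
qed

lemma definable_app:
  assumes "definable b G 1 (\<lambda>g xs. H g (xs ! 0))" and "definable b G n K"
  shows "definable b G n (\<lambda>g xs. H g (K g xs))"
  using definable_comp[of b G "[K]" "\<lambda>g xs. H g (xs ! 0)" n] assms by simp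

lemma definable_app2:
  assumes "definable b G 2 H" and "definable b G n K" and "definable b G n K'"
  shows "definable b G n (\<lambda>g xs. H g [K g xs, K' g xs])"
  using definable_comp[of b G "[K, K']" H n] assms by (auto simp: numeral_2_eq_2)

lemma definable_nth: "i < n \<Longrightarrow> definable b G n (\<lambda>g xs. xs ! i)"
  unfolding definable_def by (intro exI[of _ "Proj i"]) auto

lemma definable_tl_nth:
  "Suc i < n \<Longrightarrow> definable b G n (\<lambda>g xs. tl xs ! i)"
  by (rule definable_cong[OF definable_nth[of "Suc i"]]) (auto simp: nth_tl)

lemma definable_tl2_nth:
  "i + 2 < n \<Longrightarrow> definable b G n (\<lambda>g xs. tl (tl xs) ! i)"
  by (rule definable_cong[OF definable_nth[of "i + 2"]]) (auto simp: nth_tl)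

lemma definable_Suc: "definable b G n F \<Longrightarrow> definable b G n (\<lambda>g xs. Suc (F g xs))"
  by (rule definable_app) (auto simp: definable_def length_Suc_conv intro!: exI[of _ Succ])

lemma definable_query: "definable b G n F \<Longrightarrow> definable b G n (\<lambda>g xs. g (F g xs))"
  by (rule definable_app) (auto simp: definable_def length_Suc_conv intro!: exI[of _ Query])

lemma definable_const: "definable b G n (\<lambda>g xs. c)"
proof (induction c)
  case 0
  show ?case unfolding definable_def by (intro exI[of _ Zero]) auto
next
  case (Suc c)
  then show ?case by (rule definable_Suc)
qed

text \<open>Argument tuples as finite lists of definable functions, so that rearranging the
  arguments of a call is handled by introduction rules for \<open>#\<close>, \<open>tl\<close> and
  appending.\<close>

definition definable_list ::
    "bool \<Rightarrow> (nat \<Rightarrow> nat) set \<Rightarrow> nat \<Rightarrow> nat \<Rightarrow> ((nat \<Rightarrow> nat) \<Rightarrow> nat list \<Rightarrow> nat list) \<Rightarrow> bool" where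
  "definable_list b G n k L \<longleftrightarrow>
     (\<exists>Fs. length Fs = k \<and> (\<forall>F\<in>set Fs. definable b G n F) \<and>
       (\<forall>g\<in>G. \<forall>xs. length xs = n \<longrightarrow> L g xs = map (\<lambda>F. F g xs) Fs))"

lemma definable_apply:
  assumes "definable b G k H" and "definable_list b G n k L"
  shows "definable b G n (\<lambda>g xs. H g (L g xs))"
proof -
  obtain Fs where Fs: "length Fs = k" "\<forall>F\<in>set Fs. definable b G n F"
    "\<And>g xs. g \<in> G \<Longrightarrow> length xs = n \<Longrightarrow> L g xs = map (\<lambda>F. F g xs) Fs"
    using assms(2) unfolding definable_list_def by auto
  have "definable b G n (\<lambda>g xs. H g (map (\<lambda>F. F g xs) Fs))"
    by (rule definable_comp) (use assms(1) Fs in auto)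
  then show ?thesis by (rule definable_cong) (use Fs in auto)
qed

lemma definable_list_map:
  assumes "\<And>q. q \<in> set qs \<Longrightarrow> definable b G n (F q)"
  shows "definable_list b G n (length qs) (\<lambda>g xs. map (\<lambda>q. F q g xs) qs)"
  unfolding definable_list_def using assms by (intro exI[of _ "map F qs"]) auto

lemma definable_list_self: "definable_list b G n n (\<lambda>g xs. xs)"
  unfolding definable_list_def
  by (intro exI[of _ "map (\<lambda>i g xs. xs ! i) [0..<n]"])
    (auto simp: comp_def map_nth intro: definable_nth)

lemma definable_list_Cons:
  assumes "definable b G n F" and "definable_list b G n k L"
  shows "definable_list b G n (Suc k) (\<lambda>g xs. F g xs # L g xs)"
proof -
  obtain Fs where Fs: "length Fs = k" "\<forall>F\<in>set Fs. definable b G n F"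
    "\<And>g xs. g \<in> G \<Longrightarrow> length xs = n \<Longrightarrow> L g xs = map (\<lambda>F. F g xs) Fs"
    using assms(2) unfolding definable_list_def by auto
  then show ?thesis
    unfolding definable_list_def using assms(1) by (intro exI[of _ "F # Fs"]) auto
qed

lemma definable_list_snoc:
  assumes "definable_list b G n k L" and "definable b G n F"
  shows "definable_list b G n (Suc k) (\<lambda>g xs. L g xs @ [F g xs])"
proof -
  obtain Fs where Fs: "length Fs = k" "\<forall>F\<in>set Fs. definable b G n F"
    "\<And>g xs. g \<in> G \<Longrightarrow> length xs = n \<Longrightarrow> L g xs = map (\<lambda>F. F g xs) Fs"
    using assms(1) unfolding definable_list_def by auto
  then show ?thesis
    unfolding definable_list_def using assms(2) by (intro exI[of _ "Fs @ [F]"]) auto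
qed

lemma definable_list_tl:
  assumes "definable_list b G n (Suc k) L"
  shows "definable_list b G n k (\<lambda>g xs. tl (L g xs))"
proof -
  obtain Fs where Fs: "length Fs = Suc k" "\<forall>F\<in>set Fs. definable b G n F"
    "\<And>g xs. g \<in> G \<Longrightarrow> length xs = n \<Longrightarrow> L g xs = map (\<lambda>F. F g xs) Fs"
    using assms unfolding definable_list_def by auto
  then show ?thesis
    unfolding definable_list_def
    by (intro exI[of _ "tl Fs"], cases Fs) auto
qed

lemmas definable_lists =
  definable_list_self definable_list_Cons definable_list_snoc definable_list_tl
  definable_list_map

lemma definable_rec_nat:
  assumes "definable b G n A"
    and "definable b G (n + 2) (\<lambda>g ys. S g (ys ! 0) (ys ! 1) (tl (tl ys)))"
    and "definable b G n K"
  shows "definable b G n (\<lambda>g xs. rec_nat (A g xs) (\<lambda>m r. S g m r xs) (K g xs))"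
proof -
  obtain p where p: "has_arity n p" "b \<or> mu_free p"
    "\<And>g xs. g \<in> G \<Longrightarrow> length xs = n \<Longrightarrow> eval g p xs = Some (A g xs)"
    using assms(1) unfolding definable_def by auto
  obtain q where q: "has_arity (n + 2) q" "b \<or> mu_free q"
    "\<And>g xs. g \<in> G \<Longrightarrow> length xs = n + 2 \<Longrightarrow> eval g q xs = Some (S g (xs ! 0) (xs ! 1) (tl (tl xs)))"
    using assms(2) unfolding definable_def by auto
  have "rec_nat (eval g p xs) (\<lambda>m r. Option.bind r (\<lambda>y. eval g q (m # y # xs))) k =
      Some (rec_nat (A g xs) (\<lambda>m r. S g m r xs) k)" if "g \<in> G" "length xs = n" for g xs k
    using that by (induction k) (auto simp: p q)
  then have "definable b G (Suc n) (\<lambda>g ys. rec_nat (A g (tl ys)) (\<lambda>m r. S g m r (tl ys)) (hd ys))"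
    unfolding definable_def using p q by (intro exI[of _ "PrimRec p q"]) auto
  \<comment> \<open>\<open>PrimRec\<close> wants its recursion variable as an extra first argument;
    the bound \<open>K\<close> is substituted for it only now.\<close>
  then have "definable b G n (\<lambda>g xs. (\<lambda>g ys. rec_nat (A g (tl ys)) (\<lambda>m r. S g m r (tl ys)) (hd ys)) g
      (map (\<lambda>F. F g xs) (K # map (\<lambda>i g xs. xs ! i) [0..<n])))"
    by (intro definable_comp) (auto simp: assms(3) intro: definable_nth)
  then show ?thesis
    by (rule definable_cong) (auto simp: comp_def map_nth)
qed

lemma definable_Least:
  assumes "definable True G (Suc n) (\<lambda>g ys. F g (ys ! 0) (tl ys))"
    and "\<And>g xs. g \<in> G \<Longrightarrow> length xs = n \<Longrightarrow> \<exists>k. F g k xs = 0"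
  shows "definable True G n (\<lambda>g xs. LEAST k. F g k xs = 0)"
proof -
  obtain p where p: "has_arity (Suc n) p"
    "\<And>g xs. g \<in> G \<Longrightarrow> length xs = Suc n \<Longrightarrow> eval g p xs = Some (F g (xs ! 0) (tl xs))"
    using assms(1) unfolding definable_def by auto
  have "eval g (Mu p) xs = Some (LEAST k. F g k xs = 0)" if "g \<in> G" "length xs = n" for g xs
    using p(2)[OF that(1)] assms(2)[OF that] that(2) by (auto simp: mu_search_def)
  then show ?thesis
    unfolding definable_def using p(1) by (intro exI[of _ "Mu p"]) auto
qed

section \<open>Arithmetic and decidable predicates\<close>

lemmas definable_basic =
  definable_nth definable_tl_nth definable_tl2_nth
  definable_const definable_Suc

lemma definable_add:
  assumes "definable b G n F" and "definable b G n H"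
  shows "definable b G n (\<lambda>g xs. F g xs + H g xs)"
proof -
  have "definable b G n (\<lambda>g xs. rec_nat (F g xs) (\<lambda>m r. Suc r) (H g xs))"
    by (intro definable_rec_nat definable_basic assms) auto
  moreover have "rec_nat x (\<lambda>m. Suc) y = x + y" for x y :: nat
    by (induction y) auto
  ultimately show ?thesis by simp
qed

lemma definable_pred:
  assumes "definable b G n F"
  shows "definable b G n (\<lambda>g xs. F g xs - 1)"
proof -
  have "definable b G n (\<lambda>g xs. rec_nat 0 (\<lambda>m r. m) (F g xs))"
    by (intro definable_rec_nat definable_basic assms) auto
  moreover have "rec_nat 0 (\<lambda>m r. m) y = y - 1" for y :: nat
    by (cases y) auto
  ultimately show ?thesis by simp
qed

lemma definable_diff:
  assumes "definable b G n F" and "definable b G n H"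
  shows "definable b G n (\<lambda>g xs. F g xs - H g xs)"
proof -
  have "definable b G n (\<lambda>g xs. rec_nat (F g xs) (\<lambda>m r. r - 1) (H g xs))"
    by (intro definable_rec_nat definable_pred definable_basic assms) auto
  moreover have "rec_nat x (\<lambda>m r. r - 1) y = x - y" for x y :: nat
    by (induction y) auto
  ultimately show ?thesis by simp
qed

lemma definable_If:
  assumes "decidable b G n P" and "definable b G n F" and "definable b G n H"
    shows "definable b G n (\<lambda>g xs. if P g xs then F g xs else H g xs)"
proof -
  have tl2: "definable b G (n + 2) (\<lambda>g ys. F g (tl (tl ys)))"
    using definable_list_self[of b G "n + 2"]
    by (intro definable_apply[OF assms(2)] definable_list_tl) simp
  \<comment> \<open>A recursion of length 0 or 1 is a case distinction: length 0 returns the start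
    value, length 1 the step value.\<close>
  have "definable b G n (\<lambda>g xs. rec_nat (H g xs) (\<lambda>m r. F g xs) (of_bool (P g xs)))"
    by (intro definable_rec_nat assms tl2)
  then show ?thesis by (rule definable_cong) auto
qed

lemma definable_mult:
  assumes "definable b G n F" and "definable b G n H"
  shows "definable b G n (\<lambda>g xs. F g xs * H g xs)"
proof -
  \<comment> \<open>The binary function comes first, so that the recursion step mentions projections
    only; composition with \<open>F\<close> and \<open>H\<close> follows.\<close>
  have "definable b G 2 (\<lambda>g zs. rec_nat 0 (\<lambda>m r. zs ! 0 + r) (zs ! 1))"
    by (intro definable_rec_nat definable_add definable_basic) auto
  from definable_app2[OF this assms]
  have "definable b G n (\<lambda>g xs. rec_nat 0 (\<lambda>m r. F g xs + r) (H g xs))" by simp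
  moreover have "rec_nat 0 (\<lambda>m. (+) x) y = x * y" for x y :: nat
    by (induction y) auto
  ultimately show ?thesis by simp
qed

lemma definable_power2:
  assumes "definable b G n F"
  shows "definable b G n (\<lambda>g xs. 2 ^ F g xs)"
proof -
  have "definable b G n (\<lambda>g xs. rec_nat 1 (\<lambda>m r. 2 * r) (F g xs))"
    by (intro definable_rec_nat definable_mult definable_basic assms) auto
  moreover have "rec_nat 1 (\<lambda>m. (*) 2) y = (2::nat) ^ y" for y :: nat
    by (induction y) auto
  ultimately show ?thesis by simp
qed

lemma decidable_not:
  assumes "decidable b G n P"
  shows "decidable b G n (\<lambda>g xs. \<not> P g xs)"
  by (rule definable_cong[OF definable_diff[OF definable_const[of _ _ _ 1] assms]]) auto

lemma decidable_conj:
  assumes "decidable b G n P" and "decidable b G n Q"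
  shows "decidable b G n (\<lambda>g xs. P g xs \<and> Q g xs)"
  by (rule definable_cong[OF definable_mult[OF assms]]) auto

lemma decidable_disj:
  assumes "decidable b G n P" and "decidable b G n Q"
  shows "decidable b G n (\<lambda>g xs. P g xs \<or> Q g xs)"
  using decidable_not[OF decidable_conj[OF assms[THEN decidable_not]]] by simp

lemma decidable_imp:
  assumes "decidable b G n P" and "decidable b G n Q"
  shows "decidable b G n (\<lambda>g xs. P g xs \<longrightarrow> Q g xs)"
  using decidable_disj[OF decidable_not[OF assms(1)] assms(2)] by (simp only: imp_conv_disj)

lemma decidable_less:
  assumes "definable b G n F" and "definable b G n H"
  shows "decidable b G n (\<lambda>g xs. F g xs < H g xs)"
  \<comment> \<open>Truncated subtraction: \<open>1 - (1 - d)\<close> is 1 exactly when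
    \<open>d\<close> is positive, here with \<open>d\<close> the difference of \<open>H\<close> and
    \<open>F\<close>.\<close>
  by (rule definable_cong[OF definable_diff[OF definable_const[of _ _ _ 1]
        definable_diff[OF definable_const[of _ _ _ 1] definable_diff[OF assms(2,1)]]]]) auto

lemma decidable_eq:
  assumes "definable b G n F" and "definable b G n H"
  shows "decidable b G n (\<lambda>g xs. F g xs = H g xs)"
  by (rule definable_cong[OF decidable_conj[OF decidable_not[OF decidable_less[OF assms]]
        decidable_not[OF decidable_less[OF assms(2,1)]]]]) auto

lemma decidable_Bex_list:
  assumes "\<And>q. q \<in> set qs \<Longrightarrow> decidable b G n (P q)"
  shows "decidable b G n (\<lambda>g xs. \<exists>q\<in>set qs. P q g xs)"
  using assms
proof (induction qs)
  case Nil
  then show ?case by (simp add: definable_const)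
next
  case (Cons q qs)
  have "decidable b G n (\<lambda>g xs. P q g xs \<or> (\<exists>q\<in>set qs. P q g xs))"
    by (intro decidable_disj Cons) (use Cons.prems in auto)
  then show ?case by simp
qed

lemma definable_sum:
  assumes "definable b G n K" and "definable b G (Suc n) (\<lambda>g ys. F g (ys ! 0) (tl ys))"
  shows "definable b G n (\<lambda>g xs. \<Sum>i<K g xs. F g i xs)"
proof -
  have L: "definable_list b G (n + 2) (Suc n) (\<lambda>g ys. ys ! 0 # tl (tl ys))"
    using definable_list_self[of b G "n + 2"]
    by (intro definable_lists definable_basic) auto
  have "definable b G (n + 2) (\<lambda>g ys. F g (ys ! 0) (tl (tl ys)))"
    using definable_apply[OF assms(2) L] by simp
  then have "definable b G n (\<lambda>g xs. rec_nat 0 (\<lambda>m r. r + F g m xs) (K g xs))"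
    by (intro definable_rec_nat definable_add definable_basic assms(1)) auto
  moreover have "rec_nat 0 (\<lambda>m r. r + h m) k = (\<Sum>i<k. h i)" for h :: "nat \<Rightarrow> nat" and k
    by (induction k) auto
  ultimately show ?thesis by simp
qed

lemma decidable_all_less:
  assumes "definable b G n K" and "decidable b G (Suc n) (\<lambda>g ys. P g (ys ! 0) (tl ys))"
  shows "decidable b G n (\<lambda>g xs. \<forall>i<K g xs. P g i xs)"
proof -
  \<comment> \<open>A bounded universal quantifier says that the number of counterexamples is
    0.\<close>
  have "decidable b G n (\<lambda>g xs. (\<Sum>i<K g xs. of_bool (\<not> P g i xs)) = (0::nat))"
    by (intro decidable_eq definable_sum decidable_not definable_basic assms)
  then show ?thesis
    by (rule definable_cong) auto
qed

lemmas definable_arith = definable_add definable_diff definable_mult definable_power2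
  definable_sum definable_If decidable_not decidable_conj decidable_disj decidable_imp
  decidable_less decidable_eq decidable_all_less definable_basic


section \<open>Coding\<close>

lemma definable_div2:
  assumes "definable b G n F"
  shows "definable b G n (\<lambda>g xs. F g xs div 2)"
proof -
  \<comment> \<open>Successive halves satisfy \<open>Suc m div 2 = m - m div 2\<close>.\<close>
  have "definable b G n (\<lambda>g xs. rec_nat 0 (\<lambda>m r. m - r) (F g xs))"
    by (intro definable_rec_nat definable_arith assms) auto
  moreover have "rec_nat 0 (\<lambda>m r. m - r) y = y div 2" for y :: nat
    by (induction y) auto
  ultimately show ?thesis by simp
qed

lemma definable_mod2:
  assumes "definable b G n F"
  shows "definable b G n (\<lambda>g xs. F g xs mod 2)"
proof -
  have "definable b G n (\<lambda>g xs. F g xs - 2 * (F g xs div 2))"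
    by (intro definable_arith definable_div2 assms)
  then show ?thesis by (simp add: minus_mult_div_eq_mod)
qed

lemma definable_div_power2:
  assumes "definable b G n F" and "definable b G n H"
  shows "definable b G n (\<lambda>g xs. F g xs div 2 ^ H g xs)"
proof -
  have "definable b G n (\<lambda>g xs. rec_nat (F g xs) (\<lambda>m r. r div 2) (H g xs))"
    by (intro definable_rec_nat definable_arith definable_div2 assms) auto
  moreover have "rec_nat x (\<lambda>m r. r div 2) y = x div 2 ^ y" for x y :: nat
    by (induction y) (auto simp: mult.commute simp flip: div_mult2_eq)
  ultimately show ?thesis by simp
qed

lemma definable_triangle:
  assumes "definable b G n F"
  shows "definable b G n (\<lambda>g xs. triangle (F g xs))"
proof -
  have "definable b G n (\<lambda>g xs. F g xs * Suc (F g xs) div 2)"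
    by (intro definable_arith definable_div2 assms)
  then show ?thesis by (simp add: triangle_def)
qed

lemma definable_prod_encode:
  assumes "definable b G n F" and "definable b G n H"
  shows "definable b G n (\<lambda>g xs. prod_encode (F g xs, H g xs))"
proof -
  have "definable b G n (\<lambda>g xs. triangle (F g xs + H g xs) + F g xs)"
    by (intro definable_arith definable_triangle assms)
  then show ?thesis by (simp add: prod_encode_def)
qed

text \<open>Decoding by bounded search: both components are at most the code and the pairing is
  injective, so exactly one term of the double sum survives.\<close>

lemma sum_prod_decode:
  "(\<Sum>x<Suc z. \<Sum>y<Suc z. if prod_encode (x, y) = z then h x y else 0) =
    h (fst (prod_decode z)) (snd (prod_decode z))" for h :: "nat \<Rightarrow> nat \<Rightarrow> nat"
proof -
  obtain u v where uv: "prod_decode z = (u, v)" by fastforce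
  then have z: "z = prod_encode (u, v)" by (metis prod_decode_inverse)
  have le: "u < Suc z" "v < Suc z"
    using le_prod_encode_1[of u v] le_prod_encode_2[of v u] z by auto
  have "(\<Sum>x<Suc z. \<Sum>y<Suc z. if prod_encode (x, y) = z then h x y else 0) =
      (\<Sum>x<Suc z. if x = u then h u v else 0)"
  proof (rule sum.cong)
    fix x
    have "(\<Sum>y<Suc z. if prod_encode (x, y) = z then h x y else 0) =
        (\<Sum>y<Suc z. if y = v then (if x = u then h u v else 0) else 0)"
      by (rule sum.cong) (auto simp: z prod_encode_eq)
    then show "(\<Sum>y<Suc z. if prod_encode (x, y) = z then h x y else 0) =
        (if x = u then h u v else 0)"
      using le by simp
  qed simp
  then show ?thesis using le uv by simp
qed

lemma definable_fst_prod_decode: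
  assumes "definable b G n F"
  shows "definable b G n (\<lambda>g xs. fst (prod_decode (F g xs)))"
proof -
  have "definable b G 1 (\<lambda>g zs. \<Sum>x<Suc (zs ! 0). \<Sum>y<Suc (zs ! 0).
      if prod_encode (x, y) = zs ! 0 then x else 0)"
    by (intro definable_arith definable_prod_encode) auto
  then show ?thesis
    unfolding sum_prod_decode by (intro definable_app[OF _ assms])
qed

lemma definable_snd_prod_decode:
  assumes "definable b G n F"
  shows "definable b G n (\<lambda>g xs. snd (prod_decode (F g xs)))"
proof -
  have "definable b G 1 (\<lambda>g zs. \<Sum>x<Suc (zs ! 0). \<Sum>y<Suc (zs ! 0).
      if prod_encode (x, y) = zs ! 0 then y else 0)"
    by (intro definable_arith definable_prod_encode) auto
  then show ?thesis
    unfolding sum_prod_decode by (intro definable_app[OF _ assms])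
qed

text \<open>The code of the empty list is a fixed point, since \<open>prod_decode 0 = (0, 0)\<close>.\<close>

definition tail_code :: "nat \<Rightarrow> nat" where
  "tail_code a = snd (prod_decode (a - 1))"

lemma tail_code_list_encode: "tail_code (list_encode xs) = list_encode (tl xs)"
proof (cases xs)
  case Nil
  have "prod_encode (0, 0) = 0" by (simp add: prod_encode_def)
  then have "prod_decode 0 = (0, 0)" by (metis prod_encode_inverse)
  then show ?thesis using Nil by (simp add: tail_code_def)
qed (simp add: tail_code_def)

lemma tail_code_funpow: "(tail_code ^^ k) (list_encode xs) = list_encode (drop k xs)"
  by (induction k) (auto simp: tail_code_list_encode drop_Suc tl_drop)

lemma length_le_list_encode: "length xs \<le> list_encode xs"
proof (induction xs)
  case (Cons x xs)
  then show ?case using le_prod_encode_2[of "list_encode xs" x] by simp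
qed simp

lemma definable_tail_code_funpow:
  assumes "definable b G n F" and "definable b G n H"
  shows "definable b G n (\<lambda>g xs. (tail_code ^^ F g xs) (H g xs))"
proof -
  have "definable b G n (\<lambda>g xs. rec_nat (H g xs) (\<lambda>m r. tail_code r) (F g xs))"
    unfolding tail_code_def
    by (intro definable_rec_nat definable_arith definable_snd_prod_decode assms) auto
  moreover have "rec_nat y (\<lambda>m. tail_code) x = (tail_code ^^ x) y" for x y :: nat
    by (induction x) auto
  ultimately show ?thesis by simp
qed

lemma list_encode_eq_0 [simp]: "list_encode xs = 0 \<longleftrightarrow> xs = []"
  by (cases xs) auto

text \<open>The length is the number of \<open>i\<close> for which the \<open>i\<close>-th iterated
  tail is non-empty; the code bounds the length, so counting below the code misses none.\<close>

lemma definable_length_list_decode: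
  assumes "definable b G n F"
  shows "definable b G n (\<lambda>g xs. length (list_decode (F g xs)))"
proof -
  have len: "(\<Sum>i<a. of_bool ((tail_code ^^ i) a \<noteq> 0)) = length (list_decode a)" for a
  proof -
    define xs where "xs = list_decode a"
    then have a: "a = list_encode xs" by simp
    have "(\<Sum>i<a. of_bool ((tail_code ^^ i) a \<noteq> 0)) = (\<Sum>i<a. of_bool (i < length xs) :: nat)"
      by (rule sum.cong) (auto simp: a tail_code_funpow)
    also have "\<dots> = card ({..<a} \<inter> {i. i < length xs})"
      by (simp add: sum.If_cases flip: of_bool_def)
    also have "{..<a} \<inter> {i. i < length xs} = {..<length xs}"
      using length_le_list_encode[of xs] a by auto
    finally show ?thesis by (simp add: xs_def)
  qed
  have "definable b G 1 (\<lambda>g zs. \<Sum>i<zs ! 0. of_bool (\<not> (tail_code ^^ i) (zs ! 0) = 0))"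
    by (intro definable_arith definable_tail_code_funpow) auto
  then have "definable b G 1 (\<lambda>g zs. length (list_decode (zs ! 0)))"
    by (simp only: len)
  then show ?thesis by (intro definable_app[OF _ assms])
qed

lemma definable_map_list_decode:
  assumes "definable b G 1 (\<lambda>g xs. H g (xs ! 0))" and "definable b G n F"
  shows "definable b G n (\<lambda>g xs. list_encode (map (H g) (list_decode (F g xs))))"
proof -
  \<comment> \<open>The mapped list is rebuilt from its end. After \<open>k\<close> rounds the value
    codes the image of \<open>drop (a - k) xs\<close>; rounds that look past the end of the list
    find the code 0 and leave the empty list.\<close>
  define S where "S a h = (\<lambda>m r. if (tail_code ^^ (a - Suc m)) a = 0 then 0
      else Suc (prod_encode (h (fst (prod_decode ((tail_code ^^ (a - Suc m)) a - 1))), r)))"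
    for a and h :: "nat \<Rightarrow> nat"
  have rec: "rec_nat 0 (S a h) a = list_encode (map h (list_decode a))" for h a
  proof -
    define xs where "xs = list_decode a"
    then have a: "a = list_encode xs" by simp
    have "rec_nat 0 (S a h) k = list_encode (map h (drop (a - k) xs))" if "k \<le> a" for k
      using that
    proof (induction k)
      case 0
      then show ?case using length_le_list_encode[of xs] a by simp
    next
      case (Suc k)
      have "Suc (a - Suc k) = a - k" using Suc.prems by simp
      moreover have "(tail_code ^^ (a - Suc k)) a = list_encode (drop (a - Suc k) xs)"
        by (simp add: a tail_code_funpow)
      moreover have "drop (Suc (a - Suc k)) xs = tl (drop (a - Suc k) xs)"
        by (simp add: drop_Suc tl_drop)
      ultimately show ?case
        using Suc by (cases "drop (a - Suc k) xs") (auto simp: S_def)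
    qed
    from this[of a] show ?thesis by (simp add: xs_def)
  qed
  have "definable b G 1 (\<lambda>g zs. rec_nat 0 (S (zs ! 0) (H g)) (zs ! 0))"
    unfolding S_def
    by (intro definable_rec_nat definable_arith definable_tail_code_funpow definable_prod_encode
        definable_fst_prod_decode definable_app[OF assms(1)]) auto
  then have "definable b G 1 (\<lambda>g zs. list_encode (map (H g) (list_decode (zs ! 0))))"
    by (simp only: rec)
  then show ?thesis
    by (intro definable_app[where H = "\<lambda>g x. list_encode (map (H g) (list_decode x))", OF _ assms(2)])
qed


section \<open>Use, oracle parameters and stage approximations\<close>

lemma definable_tl:
  assumes "definable b G n F"
  shows "definable b G (Suc n) (\<lambda>g ys. F g (tl ys))"
  by (intro definable_apply[OF assms] definable_lists)

lemma eval_mu_free: "has_arity (length xs) p \<Longrightarrow> mu_free p \<Longrightarrow> eval g p xs = Some (the (eval g p xs))"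
  using eval_mu_free_total by fastforce

text \<open>The intermediate values that determine which further queries are made are primitive
  recursive in the oracle, hence so is a bound on all queries. Later the bound is evaluated at a
  whole family of oracles, so its mere existence for each of them would not suffice.\<close>

lemma ex_use_bound:
  assumes "has_arity n p" and "mu_free p"
  shows "\<exists>U. definable False UNIV n U \<and>
    (\<forall>g g' xs. length xs = n \<longrightarrow> (\<forall>x<U g xs. g' x = g x) \<longrightarrow> eval g' p xs = eval g p xs)"
  using assms
proof (induction p arbitrary: n)
  case Query
  have "definable False UNIV n (\<lambda>g xs. Suc (xs ! 0))"
    using Query by (intro definable_basic) auto
  then show ?case
    using Query by (intro exI[of _ "\<lambda>g xs. Suc (xs ! 0)"]) (auto simp: length_Suc_conv)
next
  case (Comp p qs)
  let ?k = "length qs"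
  obtain Up where Up: "definable False UNIV ?k Up"
    "\<And>g g' xs. length xs = ?k \<Longrightarrow> (\<forall>x<Up g xs. g' x = g x) \<Longrightarrow> eval g' p xs = eval g p xs"
    using Comp.IH(1)[of ?k] Comp.prems by auto
  have "\<forall>q\<in>set qs. \<exists>U. definable False UNIV n U \<and>
    (\<forall>g g' xs. length xs = n \<longrightarrow> (\<forall>x<U g xs. g' x = g x) \<longrightarrow> eval g' q xs = eval g q xs)"
    using Comp.IH(2) Comp.prems by auto
  then obtain Uq where Uq: "\<And>q. q \<in> set qs \<Longrightarrow> definable False UNIV n (Uq q)"
    "\<And>q g g' xs. q \<in> set qs \<Longrightarrow> length xs = n \<Longrightarrow> (\<forall>x<Uq q g xs. g' x = g x) \<Longrightarrow>
      eval g' q xs = eval g q xs"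
    by metis
  define v where "v q g xs = the (eval g q xs)" for q g xs
  have v: "definable False UNIV n (v q)" if "q \<in> set qs" for q
    unfolding v_def using Comp.prems that by (intro definable_eval) auto
  have sum_list: "definable False UNIV n (\<lambda>g xs. \<Sum>q\<leftarrow>rs. Uq q g xs)" if "set rs \<subseteq> set qs" for rs
    using that by (induction rs) (auto intro: definable_const definable_add Uq(1))
  \<comment> \<open>A sum dominates each of its terms: the inner uses, and the use of the outer
    scheme at the inner values.\<close>
  let ?U = "\<lambda>g xs. (\<Sum>q\<leftarrow>qs. Uq q g xs) + Up g (map (\<lambda>q. v q g xs) qs)"
  have "definable False UNIV n ?U"
    by (intro definable_add sum_list definable_apply[OF Up(1)] definable_list_map v) auto
  moreover have "eval g' (Comp p qs) xs = eval g (Comp p qs) xs"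
    if xs: "length xs = n" and agree: "\<forall>x<?U g xs. g' x = g x" for g g' xs
  proof -
    have "eval g' q xs = eval g q xs" if "q \<in> set qs" for q
    proof (rule Uq(2)[OF that xs])
      have "Uq q g xs \<le> (\<Sum>q\<leftarrow>qs. Uq q g xs)"
        using that by (intro member_le_sum_list) auto
      then show "\<forall>x<Uq q g xs. g' x = g x" using agree by auto
    qed
    then have eq: "map (\<lambda>q. eval g' q xs) qs = map (\<lambda>q. eval g q xs) qs"
      by simp
    have "\<forall>q\<in>set qs. eval g q xs = Some (v q g xs)"
      unfolding v_def using Comp.prems xs by (auto intro!: eval_mu_free)
    then have "those (map (\<lambda>q. eval g q xs) qs) = Some (map (\<lambda>q. v q g xs) qs)"
      by (intro those_map_Some) auto
    moreover have "eval g' p (map (\<lambda>q. v q g xs) qs) = eval g p (map (\<lambda>q. v q g xs) qs)"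
      using agree by (intro Up(2)) auto
    ultimately show ?thesis by (simp only: eval.simps eq bind.simps)
  qed
  ultimately show ?case by blast
next
  case (PrimRec p q)
  then obtain k where n: "n = Suc k" by (cases n) auto
  obtain Up where Up: "definable False UNIV k Up"
    "\<And>g g' xs. length xs = k \<Longrightarrow> (\<forall>x<Up g xs. g' x = g x) \<Longrightarrow> eval g' p xs = eval g p xs"
    using PrimRec.IH(1)[of k] PrimRec.prems n by auto
  obtain Uq where Uq: "definable False UNIV (Suc n) Uq"
    "\<And>g g' xs. length xs = Suc n \<Longrightarrow> (\<forall>x<Uq g xs. g' x = g x) \<Longrightarrow> eval g' q xs = eval g q xs"
    using PrimRec.IH(2)[of "Suc n"] PrimRec.prems by auto
  define v where "v g xs = the (eval g (PrimRec p q) xs)" for g xs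
  have v: "definable False UNIV n v"
    unfolding v_def by (rule definable_eval) fact+
  \<comment> \<open>Round \<open>m\<close> runs \<open>q\<close> on the value of the recursion at
    \<open>m\<close>, so its use is taken at that value, which \<open>v\<close> supplies.\<close>
  let ?U = "\<lambda>g xs. Up g (tl xs) + (\<Sum>m<xs ! 0. Uq g (m # v g (m # tl xs) # tl xs))"
  have self: "definable_list False UNIV (Suc n) (Suc (Suc k)) (\<lambda>g xs. xs)"
    using n definable_list_self by simp
  have "definable False UNIV n (\<lambda>g xs. Up g (tl xs))"
    unfolding n by (rule definable_tl[OF Up(1)])
  moreover have "definable False UNIV (Suc n)
      (\<lambda>g ys. Uq g (ys ! 0 # v g (ys ! 0 # tl (tl ys)) # tl (tl ys)))"
    using n by (intro definable_apply[OF Uq(1)] definable_apply[OF v] definable_lists definable_basic self)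
      (auto intro!: definable_lists definable_basic self definable_apply[OF v])
  ultimately have "definable False UNIV n ?U"
    using n by (intro definable_add definable_sum definable_basic) auto
  moreover have "eval g' (PrimRec p q) xs = eval g (PrimRec p q) xs"
    if xs: "length xs = n" and agree: "\<forall>x<?U g xs. g' x = g x" for g g' xs
  proof -
    \<comment> \<open>The induction stops at \<open>xs ! 0\<close> because the agreement of the
      oracles covers only the rounds below it.\<close>
    have "eval g' (PrimRec p q) (m # tl xs) = eval g (PrimRec p q) (m # tl xs)" if "m \<le> xs ! 0" for m
      using that
    proof (induction m)
      case 0
      have "eval g' p (tl xs) = eval g p (tl xs)"
        using agree xs n by (intro Up(2)) auto
      then show ?case by simp
    next
      case (Suc m)
      have 1: "eval g (PrimRec p q) (m # tl xs) = Some (v g (m # tl xs))"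
        unfolding v_def by (rule eval_mu_free) (use PrimRec.prems xs n in auto)
      have "Uq g (m # v g (m # tl xs) # tl xs) \<le> (\<Sum>m<xs ! 0. Uq g (m # v g (m # tl xs) # tl xs))"
        using Suc.prems
        by (intro member_le_sum[of m "{..<xs ! 0}" "\<lambda>m. Uq g (m # v g (m # tl xs) # tl xs)"]) auto
      then have 2: "eval g' q (m # v g (m # tl xs) # tl xs) = eval g q (m # v g (m # tl xs) # tl xs)"
        using agree xs n by (intro Uq(2)) auto
      have step: "eval h (PrimRec p q) (Suc m # tl xs) =
          Option.bind (eval h (PrimRec p q) (m # tl xs)) (\<lambda>y. eval h q (m # y # tl xs))" for h
        by simp
      have "eval g' (PrimRec p q) (m # tl xs) = eval g (PrimRec p q) (m # tl xs)"
        using Suc by simp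
      then show ?case unfolding step 1 using 2 by simp
    qed
    from this[of "xs ! 0"] show ?thesis using xs n by (cases xs) auto
  qed
  ultimately show ?case by blast
qed (auto intro: definable_const)

section \<open>The index of the oracle as an ordinary argument\<close>

lemma last_eq_nth: "length ys = Suc n \<Longrightarrow> last ys = ys ! n"
  by (cases ys rule: rev_cases) (auto simp: nth_append)

text \<open>Each query is replaced by a computation of \<open>X\<close> at the index. The index
  travels as the last argument, since primitive recursion claims the front of the list.\<close>

lemma definable_eval_param:
  assumes X: "definable False UNIV 2 (\<lambda>_ ys. X (ys ! 1) (ys ! 0))"
    and "has_arity n p" and "mu_free p"
  shows "definable False UNIV (Suc n) (\<lambda>_ ys. the (eval (X (last ys)) p (butlast ys)))"
  using assms(2,3)
proof (induction p arbitrary: n)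
  case Zero
  then show ?case by (simp add: definable_const)
next
  case Succ
  have "definable False UNIV (Suc n) (\<lambda>g ys. Suc (ys ! 0))"
    by (intro definable_basic) auto
  then show ?case
    by (rule definable_cong) (use Succ in \<open>auto simp: length_Suc_conv\<close>)
next
  case (Proj i)
  have "definable False UNIV (Suc n) (\<lambda>g ys. ys ! i)"
    using Proj by (intro definable_basic) auto
  then show ?case
    by (rule definable_cong) (use Proj in \<open>auto simp: nth_butlast\<close>)
next
  case Query
  then have n: "Suc n = 2" by simp
  show ?case
    unfolding n
    by (rule definable_cong[OF X]) (auto simp: length_Suc_conv numeral_2_eq_2)
next
  case (Comp p qs)
  let ?k = "length qs"
  have P: "definable False UNIV (Suc ?k) (\<lambda>_ ys. the (eval (X (last ys)) p (butlast ys)))"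
    using Comp.IH(1)[of ?k] Comp.prems by simp
  have Q: "definable False UNIV (Suc n) (\<lambda>_ ys. the (eval (X (last ys)) q (butlast ys)))"
    if "q \<in> set qs" for q
    using Comp.IH(2)[OF that] Comp.prems that by simp
  have "definable False UNIV (Suc n) (\<lambda>g ys. (\<lambda>_ ys. the (eval (X (last ys)) p (butlast ys))) g
      (map (\<lambda>q. the (eval (X (last ys)) q (butlast ys))) qs @ [ys ! n]))"
    by (intro definable_apply[OF P] definable_list_snoc definable_list_map Q definable_basic) auto
  then show ?case
  proof (rule definable_cong)
    fix g :: "nat \<Rightarrow> nat" and ys :: "nat list"
    assume ys: "length ys = Suc n"
    then have "\<forall>q\<in>set qs. eval (X (last ys)) q (butlast ys) =
        Some (the (eval (X (last ys)) q (butlast ys)))"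
      using Comp.prems by (auto intro!: eval_mu_free)
    then have "those (map (\<lambda>q. eval (X (last ys)) q (butlast ys)) qs) =
        Some (map (\<lambda>q. the (eval (X (last ys)) q (butlast ys))) qs)"
      by (intro those_map_Some) auto
    moreover have "ys ! n = last ys"
      using ys by (cases ys rule: rev_cases) (auto simp: nth_append)
    ultimately show "(\<lambda>_ ys. the (eval (X (last ys)) p (butlast ys))) g
      (map (\<lambda>q. the (eval (X (last ys)) q (butlast ys))) qs @ [ys ! n]) =
      the (eval (X (last ys)) (Comp p qs) (butlast ys))"
      by (simp add: comp_def)
  qed
next
  case (PrimRec p q)
  then obtain k where n: "n = Suc k" by (cases n) auto
  let ?P = "\<lambda>ys. the (eval (X (last ys)) p (butlast ys))"
  let ?Q = "\<lambda>ys. the (eval (X (last ys)) q (butlast ys))"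
  have P: "definable False UNIV (Suc k) (\<lambda>_. ?P)"
    using PrimRec.IH(1)[of k] PrimRec.prems n by simp
  have Q: "definable False UNIV (Suc (Suc n)) (\<lambda>_. ?Q)"
    using PrimRec.IH(2)[of "Suc n"] PrimRec.prems by simp
  have self: "definable_list False UNIV (Suc n + 2) (Suc (Suc (Suc (Suc k)))) (\<lambda>g xs. xs)"
    using n definable_list_self[of False UNIV "Suc n + 2"] by simp
  have "definable False UNIV (Suc n + 2) (\<lambda>g ys. ?Q (ys ! 0 # ys ! 1 # tl (tl (tl ys))))"
    unfolding n using self[unfolded n]
    by (intro definable_apply[OF Q[unfolded n]] definable_lists definable_basic) auto
  moreover have "definable False UNIV (Suc n) (\<lambda>g ys. ?P (tl ys))"
    unfolding n by (rule definable_tl[OF P])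
  ultimately have "definable False UNIV (Suc n) (\<lambda>g ys. rec_nat (?P (tl ys))
      (\<lambda>m r. ?Q (m # r # tl ys)) (ys ! 0))"
    by (intro definable_rec_nat definable_basic) auto
  then show ?case
  proof (rule definable_cong)
    fix g :: "nat \<Rightarrow> nat" and ys :: "nat list"
    assume ys: "length ys = Suc n"
    then obtain a xs e where xs: "ys = a # xs @ [e]" "length xs = k"
      using n by (cases ys; cases "tl ys" rule: rev_cases) auto
    have "eval (X e) (PrimRec p q) (m # xs) =
        Some (rec_nat (?P (tl ys)) (\<lambda>m r. ?Q (m # r # tl ys)) m)" for m
    proof (induction m)
      case 0
      then show ?case
        using eval_mu_free_total[of xs p "X e"] PrimRec.prems xs n by auto
    next
      case (Suc m)
      then show ?case
        using eval_mu_free_total[of "m # rec_nat (?P (tl ys)) (\<lambda>m r. ?Q (m # r # tl ys)) m # xs" q "X e"]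
          PrimRec.prems xs n by (auto simp: butlast_append)
    qed
    from this[of a] show "rec_nat (?P (tl ys)) (\<lambda>m r. ?Q (m # r # tl ys)) (ys ! 0) =
        the (eval (X (last ys)) (PrimRec p q) (butlast ys))"
      using xs by (simp add: butlast_append)
  qed
qed auto

lemma definable_param:
  assumes X: "definable False UNIV 2 (\<lambda>_ ys. X (ys ! 1) (ys ! 0))"
    and F: "definable False UNIV 1 F"
  shows "definable False UNIV 2 (\<lambda>_ ys. F (X (ys ! 1)) [ys ! 0])"
proof -
  obtain p where p: "has_arity 1 p" "mu_free p"
    "\<And>g xs. length xs = 1 \<Longrightarrow> eval g p xs = Some (F g xs)"
    using F unfolding definable_def by auto
  have "definable False UNIV 2 (\<lambda>_ ys. the (eval (X (last ys)) p (butlast ys)))"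
    using definable_eval_param[OF X p(1,2)] by (simp add: numeral_2_eq_2)
  then show ?thesis
    by (rule definable_cong) (auto simp: p(3) length_Suc_conv numeral_2_eq_2)
qed

section \<open>Stage approximations of query-free schemes\<close>

lemma mu_search_eq_Some:
  "mu_search F = Some y \<longleftrightarrow> F y = Some 0 \<and> (\<forall>m<y. F m \<noteq> None \<and> F m \<noteq> Some 0)"
proof
  assume "mu_search F = Some y"
  then obtain n where n: "F n = Some 0" "\<forall>m<n. F m \<noteq> None" and y: "y = (LEAST n. F n = Some 0)"
    by (auto simp: mu_search_def split: if_splits)
  have "y \<le> n" unfolding y using n(1) by (rule Least_le)
  moreover have "F y = Some 0" unfolding y using n(1) by (rule LeastI)
  moreover have "F m \<noteq> Some 0" if "m < y" for m
    using not_less_Least that unfolding y by blast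
  ultimately show "F y = Some 0 \<and> (\<forall>m<y. F m \<noteq> None \<and> F m \<noteq> Some 0)"
    using n(2) by auto
next
  assume F: "F y = Some 0 \<and> (\<forall>m<y. F m \<noteq> None \<and> F m \<noteq> Some 0)"
  then have "(LEAST n. F n = Some 0) = y"
    by (intro Least_equality) (auto simp: le_less_linear intro: leI)
  then show "mu_search F = Some y" using F by (auto simp: mu_search_def)
qed

text \<open>\<open>E xs s = Suc y\<close> says that the computation at \<open>xs\<close> is seen by stage \<open>s\<close> to converge to \<open>y\<close>.
  Building \<open>E\<close> along the scheme avoids a universal machine.\<close>

definition stage_approximation :: "nat \<Rightarrow> scheme \<Rightarrow> (nat list \<Rightarrow> nat \<Rightarrow> nat) \<Rightarrow> bool" where
  "stage_approximation n p E \<longleftrightarrow>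
     definable False UNIV (Suc n) (\<lambda>_ ys. E (butlast ys) (last ys)) \<and>
     (\<forall>xs s t. length xs = n \<longrightarrow> s \<le> t \<longrightarrow> E xs s \<noteq> 0 \<longrightarrow> E xs t = E xs s) \<and>
     (\<forall>xs y. length xs = n \<longrightarrow> (eval (\<lambda>_. 0) p xs = Some y \<longleftrightarrow> (\<exists>s. E xs s = Suc y)))"

lemma
  assumes "stage_approximation n p E"
  shows stage_definable: "definable False UNIV (Suc n) (\<lambda>_ ys. E (butlast ys) (last ys))"
    and stage_mono: "\<And>xs s t. length xs = n \<Longrightarrow> s \<le> t \<Longrightarrow> E xs s \<noteq> 0 \<Longrightarrow> E xs t = E xs s"
    and stage_eval: "\<And>xs y. length xs = n \<Longrightarrow>
      eval (\<lambda>_. 0) p xs = Some y \<longleftrightarrow> (\<exists>s. E xs s = Suc y)"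
  using assms by (simp_all add: stage_approximation_def)

text \<open>Approximations never change once non-zero, so the maximum of the individual stages
  serves all of \<open>I\<close>. The lower bound \<open>k\<close> leaves room for one more stage
  requirement, such as the outer scheme of a composition or the length of a search.\<close>

lemma ex_stage_bound:
  fixes E :: "'a \<Rightarrow> nat \<Rightarrow> nat"
  assumes "finite I" and "\<And>i. i \<in> I \<Longrightarrow> \<exists>s. E i s = Suc (v i)"
    and "\<And>i s t. i \<in> I \<Longrightarrow> s \<le> t \<Longrightarrow> E i s \<noteq> 0 \<Longrightarrow> E i t = E i s"
  shows "\<exists>s\<ge>k. \<forall>i\<in>I. E i s = Suc (v i)"
  using assms
proof (induction I)
  case (insert j I)
  then obtain s where s: "s \<ge> k" "\<forall>i\<in>I. E i s = Suc (v i)" by auto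
  obtain t where t: "E j t = Suc (v j)" using insert.prems(1)[of j] by blast
  show ?case
  proof (intro exI[of _ "max s t"] conjI ballI)
    fix i assume "i \<in> insert j I"
    then show "E i (max s t) = Suc (v i)"
      using s t insert.prems(2)[of i s "max s t"] insert.prems(2)[of j t "max s t"] by auto
  qed (use s in auto)
qed auto

lemma stage_approximation_const:
  assumes "definable False UNIV n (\<lambda>_. F)" and "\<And>xs. length xs = n \<Longrightarrow> eval (\<lambda>_. 0) p xs = Some (F xs)"
  shows "stage_approximation n p (\<lambda>xs s. Suc (F xs))"
proof -
  have "definable_list False UNIV (Suc n) n (\<lambda>_. butlast)"
    unfolding definable_list_def
    by (intro exI[of _ "map (\<lambda>i g ys. ys ! i) [0..<n]"])
      (auto intro!: definable_nth nth_equalityI simp: nth_butlast)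
  from definable_Suc[OF definable_apply[OF assms(1) this]]
  show ?thesis unfolding stage_approximation_def using assms(2) by auto
qed

text \<open>One stage \<open>s\<close> has to serve the inner and outer computations together;
  subtracting 1 strips the \<open>Suc\<close> that marks convergence.\<close>

lemma stage_approximation_Comp:
  assumes p: "stage_approximation (length qs) p Ep"
    and q: "\<And>q. q \<in> set qs \<Longrightarrow> stage_approximation n q (Eq q)"
  shows "stage_approximation n (Comp p qs)
    (\<lambda>xs s. if \<exists>q\<in>set qs. Eq q xs s = 0 then 0 else Ep (map (\<lambda>q. Eq q xs s - 1) qs) s)"
    (is "stage_approximation _ _ ?E")
  unfolding stage_approximation_def
proof (intro conjI allI impI)
  have Q: "definable False UNIV (Suc n) (\<lambda>_ ys. Eq q (butlast ys) (last ys))" if "q \<in> set qs" for q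
    by (rule stage_definable[OF q[OF that]])
  have P: "definable False UNIV (Suc (length qs)) (\<lambda>_ ys. Ep (butlast ys) (last ys))"
    by (rule stage_definable[OF p])
  have "definable False UNIV (Suc n) (\<lambda>g ys. (\<lambda>_ ys. Ep (butlast ys) (last ys)) g
      (map (\<lambda>q. Eq q (butlast ys) (last ys) - 1) qs @ [ys ! n]))"
    by (intro definable_apply[OF P] definable_list_snoc definable_list_map definable_pred Q
        definable_basic) auto
  then have "definable False UNIV (Suc n) (\<lambda>g ys.
      Ep (map (\<lambda>q. Eq q (butlast ys) (last ys) - 1) qs) (last ys))"
    by (rule definable_cong) (simp add: last_eq_nth)
  then show "definable False UNIV (Suc n) (\<lambda>_ ys. ?E (butlast ys) (last ys))"
    by (intro definable_If decidable_Bex_list decidable_eq Q definable_const)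
next
  fix xs :: "nat list" and s t :: nat
  assume xs: "length xs = n" and st: "s \<le> t" and nz: "?E xs s \<noteq> 0"
  have nzq: "\<not> (\<exists>q\<in>set qs. Eq q xs s = 0)"
  proof
    assume "\<exists>q\<in>set qs. Eq q xs s = 0"
    then have "?E xs s = 0" by (rule if_P)
    then show False using nz by simp
  qed
  have nzp: "Ep (map (\<lambda>q. Eq q xs s - 1) qs) s \<noteq> 0"
    using nz unfolding if_not_P[OF nzq] .
  have eq: "Eq q xs t = Eq q xs s" if "q \<in> set qs" for q
    using nzq that by (intro stage_mono[OF q[OF that] xs st]) auto
  have "map (\<lambda>q. Eq q xs t - 1) qs = map (\<lambda>q. Eq q xs s - 1) qs"
    using eq by (intro map_cong) auto
  moreover have "Ep (map (\<lambda>q. Eq q xs s - 1) qs) t = Ep (map (\<lambda>q. Eq q xs s - 1) qs) s"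
    by (rule stage_mono[OF p _ st nzp]) simp
  moreover have "(\<exists>q\<in>set qs. Eq q xs t = 0) \<longleftrightarrow> (\<exists>q\<in>set qs. Eq q xs s = 0)"
    using eq by auto
  ultimately show "?E xs t = ?E xs s"
    by (simp only:)
next
  fix xs :: "nat list" and y
  assume xs: "length xs = n"
  have conv: "eval (\<lambda>_. 0) q xs = Some z \<longleftrightarrow> (\<exists>s. Eq q xs s = Suc z)" if "q \<in> set qs" for q z
    by (rule stage_eval[OF q[OF that] xs])
  have mono: "Eq q xs t = Eq q xs s" if "q \<in> set qs" "s \<le> t" "Eq q xs s \<noteq> 0" for q s t
    by (rule stage_mono[OF q[OF that(1)] xs that(2,3)])
  have pconv: "eval (\<lambda>_. 0) p zs = Some z \<longleftrightarrow> (\<exists>s. Ep zs s = Suc z)" if "length zs = length qs" for zs z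
    by (rule stage_eval[OF p that])
  have pmono: "Ep zs t = Ep zs s" if "length zs = length qs" "s \<le> t" "Ep zs s \<noteq> 0" for zs s t
    by (rule stage_mono[OF p that])
  show "eval (\<lambda>_. 0) (Comp p qs) xs = Some y \<longleftrightarrow> (\<exists>s. ?E xs s = Suc y)"
  proof
    assume "eval (\<lambda>_. 0) (Comp p qs) xs = Some y"
    then obtain zs where zs: "those (map (\<lambda>q. eval (\<lambda>_. 0) q xs) qs) = Some zs"
      and y: "eval (\<lambda>_. 0) p zs = Some y"
      by (auto simp: bind_eq_Some_conv)
    define v where "v q = the (eval (\<lambda>_. 0) q xs)" for q
    have those: "those (map f rs) = Some zs \<Longrightarrow> \<forall>r\<in>set rs. f r \<noteq> None"
      for f :: "scheme \<Rightarrow> nat option" and rs zs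
      by (induction rs arbitrary: zs) (auto split: option.splits)
    have v: "eval (\<lambda>_. 0) q xs = Some (v q)" if "q \<in> set qs" for q
      using those[OF zs] that by (auto simp: v_def)
    have "those (map (\<lambda>q. eval (\<lambda>_. 0) q xs) qs) = Some (map v qs)"
      by (intro those_map_Some v)
    then have zs': "zs = map v qs" using zs by simp
    obtain s where s: "Ep zs s = Suc y" using y pconv[of zs y] zs' by auto
    obtain t where t: "t \<ge> s" "\<forall>q\<in>set qs. Eq q xs t = Suc (v q)"
      using ex_stage_bound[of "set qs" "\<lambda>q. Eq q xs" v s] conv v mono by auto
    have "map (\<lambda>q. Eq q xs t - 1) qs = zs" using t zs' by simp
    moreover have "Ep zs t = Suc y" using pmono[of zs s t] s t zs' by simp
    ultimately show "\<exists>s. ?E xs s = Suc y" using t by (intro exI[of _ t]) auto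
  next
    assume "\<exists>s. ?E xs s = Suc y"
    then obtain s where s: "\<forall>q\<in>set qs. Eq q xs s \<noteq> 0" "Ep (map (\<lambda>q. Eq q xs s - 1) qs) s = Suc y"
      by (metis nat.distinct(1))
    have "eval (\<lambda>_. 0) q xs = Some (Eq q xs s - 1)" if "q \<in> set qs" for q
      using conv[OF that] s(1) that by (metis Suc_pred' neq0_conv)
    then have "those (map (\<lambda>q. eval (\<lambda>_. 0) q xs) qs) = Some (map (\<lambda>q. Eq q xs s - 1) qs)"
      by (intro those_map_Some)
    moreover have "eval (\<lambda>_. 0) p (map (\<lambda>q. Eq q xs s - 1) qs) = Some y"
      using pconv s(2) by auto
    ultimately show "eval (\<lambda>_. 0) (Comp p qs) xs = Some y" by simp
  qed
qed

text \<open>The value 0 for "not yet seen" is passed on through all later rounds of the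
  recursion.\<close>

lemma stage_approximation_PrimRec:
  assumes p: "stage_approximation k p Ep" and q: "stage_approximation (Suc (Suc k)) q Eq"
  shows "stage_approximation (Suc k) (PrimRec p q) (\<lambda>xs s. rec_nat (Ep (tl xs) s)
    (\<lambda>m r. if r = 0 then 0 else Eq (m # (r - 1) # tl xs) s) (hd xs))"
proof -
  define T where "T ys s = rec_nat (Ep ys s) (\<lambda>m r. if r = 0 then 0 else Eq (m # (r - 1) # ys) s)"
    for ys s
  have T: "T ys s 0 = Ep ys s"
    "T ys s (Suc m) = (if T ys s m = 0 then 0 else Eq (m # (T ys s m - 1) # ys) s)" for ys s m
    by (simp_all add: T_def)
  have P: "definable False UNIV (Suc k) (\<lambda>_ ys. Ep (butlast ys) (last ys))"
    "\<And>ys s t. length ys = k \<Longrightarrow> s \<le> t \<Longrightarrow> Ep ys s \<noteq> 0 \<Longrightarrow> Ep ys t = Ep ys s"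
    "\<And>ys y. length ys = k \<Longrightarrow> eval (\<lambda>_. 0) p ys = Some y \<longleftrightarrow> (\<exists>s. Ep ys s = Suc y)"
    by (rule stage_definable[OF p] stage_mono[OF p] stage_eval[OF p]; assumption)+
  have Q: "definable False UNIV (Suc (Suc (Suc k))) (\<lambda>_ ys. Eq (butlast ys) (last ys))"
    "\<And>ys s t. length ys = Suc (Suc k) \<Longrightarrow> s \<le> t \<Longrightarrow> Eq ys s \<noteq> 0 \<Longrightarrow> Eq ys t = Eq ys s"
    "\<And>ys y. length ys = Suc (Suc k) \<Longrightarrow> eval (\<lambda>_. 0) q ys = Some y \<longleftrightarrow> (\<exists>s. Eq ys s = Suc y)"
    by (rule stage_definable[OF q] stage_mono[OF q] stage_eval[OF q]; assumption)+
  have mono: "T ys t m = T ys s m" if "length ys = k" "s \<le> t" "T ys s m \<noteq> 0" for ys s t m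
    using that(3)
  proof (induction m)
    case 0
    then show ?case using P(2) that by (simp add: T)
  next
    case (Suc m)
    then have "T ys s m \<noteq> 0" by (auto simp: T split: if_splits)
    then show ?case
      using Suc Q(2)[of "m # (T ys s m - 1) # ys" s t] that by (simp add: T)
  qed
  have conv: "eval (\<lambda>_. 0) (PrimRec p q) (m # ys) = Some y \<longleftrightarrow> (\<exists>s. T ys s m = Suc y)"
    if ys: "length ys = k" for ys m y
  proof (induction m arbitrary: y)
    case 0
    then show ?case using P(3)[OF ys] by (simp add: T)
  next
    case (Suc m)
    have "eval (\<lambda>_. 0) (PrimRec p q) (Suc m # ys) = Some y \<longleftrightarrow>
        (\<exists>z. eval (\<lambda>_. 0) (PrimRec p q) (m # ys) = Some z \<and> eval (\<lambda>_. 0) q (m # z # ys) = Some y)"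
      by (simp add: bind_eq_Some_conv)
    also have "\<dots> \<longleftrightarrow> (\<exists>z. (\<exists>s. T ys s m = Suc z) \<and> (\<exists>s. Eq (m # z # ys) s = Suc y))"
      using Suc Q(3) ys by simp
    also have "\<dots> \<longleftrightarrow> (\<exists>s. T ys s (Suc m) = Suc y)"
    proof
      assume "\<exists>z. (\<exists>s. T ys s m = Suc z) \<and> (\<exists>s. Eq (m # z # ys) s = Suc y)"
      then obtain z s t where "T ys s m = Suc z" "Eq (m # z # ys) t = Suc y" by blast
      then have "T ys (max s t) m = Suc z" "Eq (m # z # ys) (max s t) = Suc y"
        using mono[OF ys, of s "max s t" m] Q(2)[of "m # z # ys" t "max s t"] ys by auto
      then show "\<exists>s. T ys s (Suc m) = Suc y" by (intro exI[of _ "max s t"]) (simp add: T)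
    next
      assume "\<exists>s. T ys s (Suc m) = Suc y"
      then obtain s where "T ys s m \<noteq> 0" "Eq (m # (T ys s m - 1) # ys) s = Suc y"
        by (auto simp: T split: if_splits)
      then show "\<exists>z. (\<exists>s. T ys s m = Suc z) \<and> (\<exists>s. Eq (m # z # ys) s = Suc y)"
        by (intro exI[of _ "T ys s m - 1"]) auto
    qed
    finally show ?case .
  qed
  let ?P = "\<lambda>ys. Ep (butlast ys) (last ys)" and ?Q = "\<lambda>ys. Eq (butlast ys) (last ys)"
  have self: "definable_list False UNIV (Suc (Suc k) + 2) (Suc (Suc (Suc (Suc k)))) (\<lambda>g xs. xs)"
    using definable_list_self[of False UNIV "Suc (Suc k) + 2"] by simp
  have "definable False UNIV (Suc (Suc k) + 2)
      (\<lambda>g ys. ?Q (ys ! 0 # (ys ! 1 - 1) # tl (tl (tl ys))))"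
    by (intro definable_apply[OF Q(1)] definable_list_Cons definable_list_tl self definable_pred
        definable_basic) auto
  moreover have "definable False UNIV (Suc (Suc k)) (\<lambda>g ys. ?P (tl ys))"
    by (rule definable_tl[OF P(1)])
  ultimately have "definable False UNIV (Suc (Suc k)) (\<lambda>g ys. rec_nat (?P (tl ys))
      (\<lambda>m r. if r = 0 then 0 else ?Q (m # (r - 1) # tl ys)) (ys ! 0))"
    by (intro definable_rec_nat definable_If decidable_eq definable_basic) auto
  then have "definable False UNIV (Suc (Suc k))
      (\<lambda>g ys. T (tl (butlast ys)) (last ys) (hd (butlast ys)))"
  proof (rule definable_cong)
    fix g :: "nat \<Rightarrow> nat" and ys :: "nat list"
    assume "length ys = Suc (Suc k)"
    then obtain a xs e where xs: "ys = a # xs @ [e]" "length xs = k"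
      by (cases ys; cases "tl ys" rule: rev_cases) auto
    then show "rec_nat (?P (tl ys)) (\<lambda>m r. if r = 0 then 0 else ?Q (m # (r - 1) # tl ys)) (ys ! 0) =
        T (tl (butlast ys)) (last ys) (hd (butlast ys))"
      by (simp add: T_def butlast_append cong: if_cong)
  qed
  moreover have "eval (\<lambda>_. 0) (PrimRec p q) xs = Some y \<longleftrightarrow> (\<exists>s. T (tl xs) s (hd xs) = Suc y)"
    if "length xs = Suc k" for xs y
    using conv[of "tl xs" "hd xs" y] that by (cases xs) auto
  ultimately have "stage_approximation (Suc k) (PrimRec p q) (\<lambda>xs s. T (tl xs) s (hd xs))"
    unfolding stage_approximation_def using mono by auto
  then show ?thesis unfolding T_def .
qed

text \<open>The approximation value 1 means convergence to 0, and a larger one convergence to a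
  positive number. At most one \<open>i\<close> meets the condition, so the sum returns
  \<open>Suc i\<close> for it; the bound \<open>i < s\<close> keeps the search finite.\<close>

lemma stage_approximation_Mu:
  assumes p: "stage_approximation (Suc n) p Ep"
  shows "stage_approximation n (Mu p) (\<lambda>xs s. \<Sum>i<s.
    if Ep (i # xs) s = 1 \<and> (\<forall>m<i. 1 < Ep (m # xs) s) then Suc i else 0)"
proof -
  define C where "C i xs s \<longleftrightarrow> Ep (i # xs) s = 1 \<and> (\<forall>m<i. 1 < Ep (m # xs) s)" for i xs s
  let ?E = "\<lambda>xs s. \<Sum>i<s. if C i xs s then Suc i else 0"
  have P: "definable False UNIV (Suc (Suc n)) (\<lambda>_ ys. Ep (butlast ys) (last ys))"
    "\<And>ys s t. length ys = Suc n \<Longrightarrow> s \<le> t \<Longrightarrow> Ep ys s \<noteq> 0 \<Longrightarrow> Ep ys t = Ep ys s"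
    "\<And>ys y. length ys = Suc n \<Longrightarrow> eval (\<lambda>_. 0) p ys = Some y \<longleftrightarrow> (\<exists>s. Ep ys s = Suc y)"
    by (rule stage_definable[OF p] stage_mono[OF p] stage_eval[OF p]; assumption)+
  have unique: "i = j" if "C i xs s" "C j xs s" for i j xs s
    using that unfolding C_def by (metis less_irrefl nat_neq_iff)
  have E1: "?E xs s = Suc i" if "C i xs s" "i < s" for i xs s
  proof -
    have "?E xs s = (\<Sum>j<s. if j = i then Suc i else 0)"
      by (rule sum.cong) (use that unique in auto)
    then show ?thesis using that by simp
  qed
  have E2: "\<exists>i<s. C i xs s" if "?E xs s \<noteq> 0" for xs s
  proof (rule ccontr)
    assume "\<not> (\<exists>i<s. C i xs s)"
    then have "?E xs s = 0" by auto
    then show False using that by simp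
  qed
  have C_mono: "C i xs t" if xs: "length xs = n" and "s \<le> t" "C i xs s" for i xs s t
  proof -
    have "Ep (i # xs) t = Ep (i # xs) s"
      using that by (intro P(2)) (auto simp: C_def)
    moreover have "Ep (m # xs) t = Ep (m # xs) s" if "m < i" for m
      using \<open>C i xs s\<close> \<open>s \<le> t\<close> xs that by (intro P(2)) (auto simp: C_def)
    ultimately show ?thesis using that by (auto simp: C_def)
  qed
  have C_sum: "?E xs s = Suc y \<longleftrightarrow> y < s \<and> C y xs s" for xs s y
    using E1[of y xs s] E2[of xs s] E1 by (metis Suc_inject nat.distinct(1))
  have "eval (\<lambda>_. 0) (Mu p) xs = Some y \<longleftrightarrow> (\<exists>s. ?E xs s = Suc y)" if xs: "length xs = n" for xs y
  proof
    assume "eval (\<lambda>_. 0) (Mu p) xs = Some y"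
    then have y: "eval (\<lambda>_. 0) p (y # xs) = Some 0"
      and less: "\<And>m. m < y \<Longrightarrow> eval (\<lambda>_. 0) p (m # xs) \<noteq> None \<and> eval (\<lambda>_. 0) p (m # xs) \<noteq> Some 0"
      by (auto simp: mu_search_eq_Some)
    define v where "v m = the (eval (\<lambda>_. 0) p (m # xs))" for m
    have v: "eval (\<lambda>_. 0) p (m # xs) = Some (v m)" if "m \<le> y" for m
      using that y less[of m] by (cases "m = y") (auto simp: v_def)
    have "\<exists>s\<ge>Suc y. \<forall>m\<in>{..y}. Ep (m # xs) s = Suc (v m)"
      using P(3) P(2) v xs by (intro ex_stage_bound) auto
    then obtain s where s: "s \<ge> Suc y" "\<forall>m\<le>y. Ep (m # xs) s = Suc (v m)" by auto
    have "v y = 0" using v[of y] y by simp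
    moreover have "v m > 0" if "m < y" for m
      using less[OF that] v[of m] that by auto
    ultimately have "C y xs s" unfolding C_def using s by auto
    then show "\<exists>s. ?E xs s = Suc y" using s C_sum by (metis Suc_le_eq)
  next
    assume "\<exists>s. ?E xs s = Suc y"
    then obtain s where s: "C y xs s" using C_sum by blast
    have "eval (\<lambda>_. 0) p (m # xs) = Some (Ep (m # xs) s - 1)" if "m \<le> y" for m
    proof -
      have "Ep (m # xs) s \<noteq> 0" using s that by (cases "m < y") (auto simp: C_def le_less)
      then show ?thesis using P(3)[of "m # xs"] xs by (metis Suc_pred' length_Cons neq0_conv)
    qed
    then show "eval (\<lambda>_. 0) (Mu p) xs = Some y"
      using s by (auto simp: mu_search_eq_Some C_def)
  qed
  moreover have "?E xs t = ?E xs s" if "length xs = n" "s \<le> t" "?E xs s \<noteq> 0" for xs s t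
  proof -
    obtain i where "i < s" "C i xs s" using E2 \<open>?E xs s \<noteq> 0\<close> by blast
    then show ?thesis using E1[of i xs s] E1[of i xs t] C_mono[of xs s t i] that by simp
  qed
  moreover have "definable False UNIV (Suc n) (\<lambda>_ ys. ?E (butlast ys) (last ys))"
  proof -
    let ?P = "\<lambda>ys. Ep (butlast ys) (last ys)"
    have self: "definable_list False UNIV (Suc (Suc n)) (Suc (Suc n)) (\<lambda>g xs. xs)"
      "definable_list False UNIV (Suc (Suc (Suc n))) (Suc (Suc (Suc n))) (\<lambda>g xs. xs)"
      by (rule definable_list_self)+
    have "definable False UNIV (Suc n) (\<lambda>_ ys. \<Sum>i<ys ! n.
        if ?P (i # ys) = 1 \<and> (\<forall>m<i. 1 < ?P (m # ys)) then Suc i else 0)"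
      by (intro definable_arith definable_apply[OF P(1)] definable_list_Cons definable_list_tl self) auto
    then show ?thesis
    proof (rule definable_cong)
      fix g :: "nat \<Rightarrow> nat" and ys :: "nat list"
      assume ys: "length ys = Suc n"
      then have "ys \<noteq> []" "ys ! n = last ys" by (auto simp: last_eq_nth)
      then show "(\<Sum>i<ys ! n. if ?P (i # ys) = 1 \<and> (\<forall>m<i. 1 < ?P (m # ys)) then Suc i else 0) =
          ?E (butlast ys) (last ys)"
        by (simp add: C_def)
    qed
  qed
  ultimately have "stage_approximation n (Mu p) ?E"
    unfolding stage_approximation_def by blast
  then show ?thesis unfolding C_def .
qed

lemma ex_stage_approximation:
  "has_arity n p \<Longrightarrow> query_free p \<Longrightarrow> \<exists>E. stage_approximation n p E"
proof (induction p arbitrary: n)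
  case Zero
  show ?case by (rule exI, rule stage_approximation_const[OF definable_const]) auto
next
  case Succ
  have "stage_approximation n Succ (\<lambda>xs s. Suc (Suc (xs ! 0)))"
    using Succ by (intro stage_approximation_const definable_basic) (auto simp: length_Suc_conv)
  then show ?case by blast
next
  case (Proj i)
  have "stage_approximation n (Proj i) (\<lambda>xs s. Suc (xs ! i))"
    using Proj by (intro stage_approximation_const definable_basic) auto
  then show ?case by blast
next
  case (Comp p qs)
  obtain Ep where "stage_approximation (length qs) p Ep"
    using Comp.IH(1)[of "length qs"] Comp.prems by auto
  moreover have "\<forall>q\<in>set qs. \<exists>E. stage_approximation n q E"
    using Comp.IH(2) Comp.prems by auto
  then obtain Eq where "\<And>q. q \<in> set qs \<Longrightarrow> stage_approximation n q (Eq q)" by metis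
  ultimately show ?case using stage_approximation_Comp by blast
next
  case (PrimRec p q)
  then obtain k where "n = Suc k" by (cases n) auto
  moreover obtain Ep where "stage_approximation k p Ep"
    using PrimRec.IH(1)[of k] PrimRec.prems \<open>n = Suc k\<close> by auto
  moreover obtain Eq where "stage_approximation (Suc (Suc k)) q Eq"
    using PrimRec.IH(2)[of "Suc (Suc k)"] PrimRec.prems \<open>n = Suc k\<close> by auto
  ultimately show ?case using stage_approximation_PrimRec by blast
next
  case (Mu p)
  then obtain E where "stage_approximation (Suc n) p E" by auto
  then show ?case using stage_approximation_Mu by blast
qed auto


section \<open>Reducibilities\<close>

lemma turing_le_iff: "f \<le>\<^sub>T g \<longleftrightarrow> definable True {g} 1 (\<lambda>_ xs. f (xs ! 0))"
  unfolding turing_le_def definable_def by (auto simp: length_Suc_conv)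

lemma pr_le_iff: "f \<le>\<^bsub>PR\<^esub> g \<longleftrightarrow> definable False {g} 1 (\<lambda>_ xs. f (xs ! 0))"
  unfolding pr_le_def definable_def by (auto simp: length_Suc_conv)

lemma computable_iff: "computable f \<longleftrightarrow> definable True {\<lambda>_. 0} 1 (\<lambda>_ xs. f (xs ! 0))"
proof
  show "definable True {\<lambda>_. 0} 1 (\<lambda>_ xs. f (xs ! 0))" if "computable f"
    using that unfolding computable_def definable_def by (auto simp: length_Suc_conv)
  assume "definable True {\<lambda>_. 0} 1 (\<lambda>_ xs. f (xs ! 0))"
  from definable_query_free[OF this definable_const, of "\<lambda>_. 0"]
  show "computable f" unfolding computable_def by (auto simp: length_Suc_conv)
qed

lemma prim_recursive1I:
  assumes "definable False {g} 1 (\<lambda>_ xs. f (xs ! 0))"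
    and "definable False UNIV 1 (\<lambda>_ xs. g (xs ! 0))"
  shows "prim_recursive1 f"
  using definable_query_free[OF assms, of "\<lambda>_. 0"] unfolding prim_recursive_def
  by (auto simp: length_Suc_conv)

lemma prim_recursive1_definable:
  assumes "prim_recursive1 f"
  shows "definable b G 1 (\<lambda>_ xs. f (xs ! 0))"
  by (rule definable_cong[OF prim_recursive_definable[OF assms]]) (auto simp: length_Suc_conv)

lemma turing_le_trans: "f \<le>\<^sub>T g \<Longrightarrow> g \<le>\<^sub>T h \<Longrightarrow> f \<le>\<^sub>T h"
  unfolding turing_le_iff by (rule definable_oracle_subst[where F = "\<lambda>_ xs. f (xs ! 0)"])

lemma pr_le_trans: "f \<le>\<^bsub>PR\<^esub> g \<Longrightarrow> g \<le>\<^bsub>PR\<^esub> h \<Longrightarrow> f \<le>\<^bsub>PR\<^esub> h"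
  unfolding pr_le_iff by (rule definable_oracle_subst[where F = "\<lambda>_ xs. f (xs ! 0)"])

lemma turing_degree_eqI: "f \<le>\<^sub>T g \<Longrightarrow> g \<le>\<^sub>T f \<Longrightarrow> turing_degree f = turing_degree g"
  unfolding turing_degree_def using turing_le_trans by blast

lemma turing_degree_computable:
  assumes "computable f"
  shows "turing_degree f = zero_turing_degree"
proof -
  have f: "f \<le>\<^sub>T g" for g
    using assms unfolding computable_def turing_le_def by (metis eval_query_free)
  have "computable g \<longleftrightarrow> g \<le>\<^sub>T f" for g
  proof
    assume "computable g"
    then show "g \<le>\<^sub>T f" unfolding computable_def turing_le_def by (metis eval_query_free)
  next
    assume "g \<le>\<^sub>T f"
    from turing_le_trans[OF this f] show "computable g"
      unfolding computable_iff turing_le_iff .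
  qed
  then show ?thesis unfolding turing_degree_def zero_turing_degree_def using f by blast
qed


section \<open>Settling counts\<close>

text \<open>\<open>Q k x\<close> is read as "\<open>k\<close> is settled by stage \<open>x\<close>".
  The counter rises by at most one per stage, so a single bit records each stage.\<close>

primrec settle_count :: "(nat \<Rightarrow> nat \<Rightarrow> bool) \<Rightarrow> nat \<Rightarrow> nat" where
  "settle_count Q 0 = 0"
| "settle_count Q (Suc x) = settle_count Q x + of_bool (Q (settle_count Q x) x)"

lemma mono_settle_count: "mono (settle_count Q)"
  by (rule mono_iff_le_Suc[THEN iffD2]) auto

text \<open>The counter never skips a value, so it leaves \<open>k\<close> at a stage where it
  stands at \<open>k\<close> and \<open>Q k\<close> holds.\<close>

lemma settle_count_crossing:
  "k < settle_count Q z \<Longrightarrow> \<exists>y<z. Q k y"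
proof (induction z)
  case (Suc z)
  show ?case
  proof (cases "k < settle_count Q z")
    case True
    then show ?thesis using Suc.IH less_SucI by blast
  next
    case False
    then have "Q k z" using Suc.prems by (cases "Q (settle_count Q z) z") (auto simp: not_less less_Suc_eq)
    then show ?thesis by blast
  qed
qed simp

lemma settle_count_unbounded:
  assumes "\<And>k. \<exists>x. \<forall>y\<ge>x. Q k y"
  shows "\<exists>z. k < settle_count Q z"
proof (induction k rule: less_induct)
  case (less k)
  obtain z where z: "k \<le> settle_count Q z"
    using less[of "k - 1"] by (cases k) (auto simp: Suc_le_eq)
  obtain x where x: "\<And>y. y \<ge> x \<Longrightarrow> Q k y" using assms by blast
  have "k \<le> settle_count Q (max x z)"
    using z monoD[OF mono_settle_count, of z "max x z" Q] by simp
  \<comment> \<open>At this stage the counter is either beyond \<open>k\<close> already, or it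
    stands at \<open>k\<close> with \<open>Q k\<close> true and moves on.\<close>
  then have "k < settle_count Q (Suc (max x z))"
    using x[of "max x z"] by (cases "k = settle_count Q (max x z)") auto
  then show ?case ..
qed

text \<open>The bits of \<open>e\<close> record the steps of a counter that eventually stops.\<close>

definition bit_count :: "nat \<Rightarrow> nat \<Rightarrow> nat" where
  "bit_count e x = (\<Sum>y<x. e div 2 ^ y mod 2)"

lemma definable_bit_count:
  assumes "definable b G n F" and "definable b G n H"
  shows "definable b G n (\<lambda>g xs. bit_count (F g xs) (H g xs))"
proof -
  have "definable b G 2 (\<lambda>g zs. bit_count (zs ! 0) (zs ! 1))"
    unfolding bit_count_def
    by (intro definable_sum definable_mod2 definable_div_power2 definable_basic) auto
  from definable_app2[OF this assms] show ?thesis by simp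
qed

lemma ex_bit_code: "\<exists>e<2 ^ s. \<forall>y. e div 2 ^ y mod 2 = (of_bool (y < s \<and> \<beta> y) :: nat)"
proof (induction s arbitrary: \<beta>)
  case (Suc s)
  obtain e where e: "e < 2 ^ s" "\<And>y. e div 2 ^ y mod 2 = (of_bool (y < s \<and> \<beta> (Suc y)) :: nat)"
    using Suc[of "\<lambda>y. \<beta> (Suc y)"] by blast
  let ?e = "of_bool (\<beta> 0) + 2 * e"
  have "?e div 2 ^ y mod 2 = of_bool (y < Suc s \<and> \<beta> y)" for y
  proof (cases y)
    case (Suc z)
    have "?e div 2 ^ y = ?e div 2 div 2 ^ z"
      by (simp add: Suc div_mult2_eq)
    also have "?e div 2 = e" by (cases "\<beta> 0") auto
    finally show ?thesis using e(2)[of z] Suc by simp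
  qed (cases "\<beta> 0"; simp add: mod_Suc)
  moreover have "?e < 2 ^ Suc s" using e(1) by (cases "\<beta> 0") auto
  ultimately show ?case by blast
qed auto

text \<open>The bits are the actual steps of the counter before stage \<open>s\<close>. Only the
  existence of the code and its bound matter: \<open>Q\<close> is arbitrary, and the code is later
  reached by running through all numbers below the bound.\<close>

lemma ex_bit_count_eq_settle_count:
  "\<exists>e<2 ^ s. \<forall>x. bit_count e x = settle_count Q (min x s)"
proof -
  obtain e where e: "e < 2 ^ s"
    "\<And>y. e div 2 ^ y mod 2 = (of_bool (y < s \<and> Q (settle_count Q y) y) :: nat)"
    using ex_bit_code[of s "\<lambda>y. Q (settle_count Q y) y"] by blast
  have "bit_count e x = settle_count Q (min x s)" for x
  proof (induction x)
    case (Suc x)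
    have "bit_count e (Suc x) = bit_count e x + of_bool (x < s \<and> Q (settle_count Q x) x)"
      unfolding bit_count_def using e(2) by simp
    then show ?case using Suc by (cases "x < s") (auto simp: min_def)
  qed (simp add: bit_count_def)
  then show ?thesis using e(1) by blast
qed

text \<open>The test \<open>C\<close> accepts the true counter and rejects each finite one after
  reading finitely many values. A finite counter that copies the true one up to some stage must
  therefore disagree with it within the rejection length, which forces the true counter to move
  there.\<close>

lemma ex_computable_settling_bound:
  assumes C: "definable False UNIV 1 C" and zero: "\<And>w. C (settle_count Q) [w] = 0"
    and nonzero: "\<And>e. \<exists>w. C (bit_count e) [w] \<noteq> 0"
  shows "\<exists>B. computable B \<and> (\<forall>k. k \<le> settle_count Q (B k))"
proof -
  obtain p where p: "has_arity 1 p" "mu_free p"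
    "\<And>g xs. length xs = 1 \<Longrightarrow> eval g p xs = Some (C g xs)"
    using C unfolding definable_def by auto
  obtain U where U: "definable False UNIV 1 U"
    "\<And>g g' xs. length xs = 1 \<Longrightarrow> (\<forall>x<U g xs. g' x = g x) \<Longrightarrow> eval g' p xs = eval g p xs"
    using ex_use_bound[OF p(1,2)] by blast
  have X: "definable False UNIV 2 (\<lambda>_ ys. bit_count (ys ! 1) (ys ! 0))"
    by (intro definable_bit_count definable_basic) auto
  \<comment> \<open>The first argument at which the test rejects the finite counter
    \<open>e\<close>, phrased as a search for a zero to fit \<open>definable_Least\<close>.\<close>
  define V where "V e = (LEAST w. (if C (bit_count e) [w] = 0 then 1 else 0) = (0::nat))" for e
  have V: "C (bit_count e) [V e] \<noteq> 0" for e
  proof -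
    obtain w where "C (bit_count e) [w] \<noteq> 0" using nonzero by blast
    then have "(if C (bit_count e) [w] = 0 then 1 else 0) = (0::nat)" by simp
    from LeastI[of "\<lambda>w. (if C (bit_count e) [w] = 0 then 1 else 0) = (0::nat)", OF this]
    show ?thesis unfolding V_def[symmetric] by (auto split: if_splits)
  qed
  let ?G = "{\<lambda>_. 0} :: (nat \<Rightarrow> nat) set"
  have "definable True ?G 2 (\<lambda>_ ys. C (bit_count (tl ys ! 0)) [ys ! 0])"
    by (rule definable_cong[OF definable_mono[OF definable_param[OF X C]]]) (auto simp: nth_tl)
  then have "definable True ?G (Suc 1)
      (\<lambda>_ ys. if C (bit_count (tl ys ! 0)) [ys ! 0] = 0 then 1 else 0)"
    by (intro definable_If decidable_eq definable_const) (simp add: numeral_2_eq_2)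
  then have defV: "definable True ?G 1 (\<lambda>_ xs. V (xs ! 0))"
    unfolding V_def using nonzero by (intro definable_Least) auto
  \<comment> \<open>The rejection of \<open>e\<close> depends only on the oracle values below
    \<open>N e\<close>.\<close>
  define N where "N e = U (bit_count e) [V e]" for e
  have "definable True ?G 1 (\<lambda>_ xs. U (bit_count ([V (xs ! 0), xs ! 0] ! 1)) [[V (xs ! 0), xs ! 0] ! 0])"
    by (rule definable_app2[OF definable_mono[OF definable_param[OF X U(1)]] defV definable_nth]) simp
  then have defN: "definable True ?G 1 (\<lambda>_ xs. N (xs ! 0))"
    by (simp add: N_def)
  \<comment> \<open>With \<open>r\<close> the previous stage, all counters coded by \<open>r\<close>
    bits are considered; the sum dominates \<open>N\<close> at the unknown code of the true
    one.\<close>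
  define B where "B k = rec_nat 0 (\<lambda>_ r. \<Sum>e<2 ^ r. N e) k" for k
  have "definable True ?G 1 (\<lambda>_ xs. B (xs ! 0))"
    unfolding B_def
    by (intro definable_rec_nat definable_sum definable_power2 definable_app[OF defN] definable_basic) auto
  then have "computable B" unfolding computable_iff .
  moreover have "k \<le> settle_count Q (B k)" for k
  proof (induction k)
    case (Suc k)
    obtain e where e: "e < 2 ^ B k" "\<And>x. bit_count e x = settle_count Q (min x (B k))"
      using ex_bit_count_eq_settle_count by blast
    \<comment> \<open>Otherwise the test could not tell the two oracles apart and would reject the
      true counter as well.\<close>
    have "\<exists>x<N e. settle_count Q x \<noteq> bit_count e x"
    proof (rule ccontr)
      assume "\<not> (\<exists>x<N e. settle_count Q x \<noteq> bit_count e x)"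
      then have "eval (settle_count Q) p [V e] = eval (bit_count e) p [V e]"
        by (intro U(2)) (auto simp: N_def)
      then show False using p(3)[of "[V e]"] zero V by simp
    qed
    then obtain x where x: "x < N e" "settle_count Q x \<noteq> settle_count Q (min x (B k))"
      using e(2) by auto
    \<comment> \<open>Up to stage \<open>B k\<close> the two counters coincide by the choice of
      \<open>e\<close>.\<close>
    then have "B k < x" by (cases "x \<le> B k") (auto simp: min_def)
    then have "settle_count Q (B k) < settle_count Q x"
      using x(2) monoD[OF mono_settle_count, of "B k" x Q] by (auto simp: min_def split: if_splits)
    also have "x \<le> B (Suc k)"
      using x(1) member_le_sum[of e "{..<2 ^ B k}" N] e(1) by (simp add: B_def)
    then have "settle_count Q x \<le> settle_count Q (B (Suc k))"
      by (rule monoD[OF mono_settle_count])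
    finally show ?case using Suc by simp
  qed simp
  ultimately show ?thesis by blast
qed


section \<open>Isomorphisms as a closed condition on the oracle\<close>

text \<open>With \<open>K\<close> as candidate inverse, bijectivity and preservation of all symbols
  are conjunctions of pointwise equations, so a single universal quantifier over \<open>w\<close>
  expresses them.\<close>

lemma ex_isomorphism_test:
  assumes A: "punctual L A" and B: "punctual L B"
    and H: "definable False UNIV 1 (\<lambda>g xs. H g (xs ! 0))"
    and K: "definable False UNIV 1 (\<lambda>g xs. K g (xs ! 0))"
  shows "\<exists>C. definable False UNIV 1 C \<and>
    (\<forall>g. (\<forall>w. C g [w] = 0) \<longleftrightarrow> isomorphism L A B (H g) \<and> inv (H g) = K g)"
proof -
  have L: "definable False UNIV 1 (\<lambda>_ xs. char_fun (fun_syms L) (xs ! 0))"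
    "definable False UNIV 1 (\<lambda>_ xs. fun_ar L (xs ! 0))"
    "definable False UNIV 1 (\<lambda>_ xs. char_fun (rel_syms L) (xs ! 0))"
    "definable False UNIV 1 (\<lambda>_ xs. rel_ar L (xs ! 0))"
    using A unfolding punctual_def prim_recursive_language_def
    by (blast intro: prim_recursive1_definable)+
  obtain FA RA where FA: "definable False UNIV 2 (\<lambda>_. FA)" "definable False UNIV 2 (\<lambda>_. RA)"
    "\<And>i xs. i \<in> fun_syms L \<Longrightarrow> length xs = fun_ar L i \<Longrightarrow> FA [i, list_encode xs] = fun_int A i xs"
    "\<And>i xs. i \<in> rel_syms L \<Longrightarrow> length xs = rel_ar L i \<Longrightarrow>
      RA [i, list_encode xs] = of_bool (rel_int A i xs)"
    using A prim_recursive_definable unfolding punctual_def by blast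
  obtain FB RB where FB: "definable False UNIV 2 (\<lambda>_. FB)" "definable False UNIV 2 (\<lambda>_. RB)"
    "\<And>i xs. i \<in> fun_syms L \<Longrightarrow> length xs = fun_ar L i \<Longrightarrow> FB [i, list_encode xs] = fun_int B i xs"
    "\<And>i xs. i \<in> rel_syms L \<Longrightarrow> length xs = rel_ar L i \<Longrightarrow>
      RB [i, list_encode xs] = of_bool (rel_int B i xs)"
    using B prim_recursive_definable unfolding punctual_def by blast
  \<comment> \<open>The argument \<open>w\<close> of the test codes a pair: a symbol
    \<open>i\<close> and a number \<open>a\<close>, which serves both as a single element in the
    inverse equations and as the code of an argument tuple.\<close>
  define T where "T g i a \<longleftrightarrow> H g (K g a) = a \<and> K g (H g a) = a \<and>
      (char_fun (fun_syms L) i = 1 \<and> length (list_decode a) = fun_ar L i \<longrightarrow>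
        H g (FA [i, a]) = FB [i, list_encode (map (H g) (list_decode a))]) \<and>
      (char_fun (rel_syms L) i = 1 \<and> length (list_decode a) = rel_ar L i \<longrightarrow>
        RA [i, a] = RB [i, list_encode (map (H g) (list_decode a))])" for g i a
  let ?C = "\<lambda>g xs. of_bool (\<not> T g (fst (prod_decode (xs ! 0))) (snd (prod_decode (xs ! 0)))) :: nat"
  have "decidable False UNIV 2 (\<lambda>g zs. T g (zs ! 0) (zs ! 1))"
    unfolding T_def
    by (intro decidable_conj decidable_imp decidable_eq definable_app2[OF FA(1)] definable_app2[OF FA(2)]
        definable_app2[OF FB(1)] definable_app2[OF FB(2)] definable_app[OF H] definable_app[OF K]
        definable_app[OF L(1)] definable_app[OF L(2)] definable_app[OF L(3)] definable_app[OF L(4)]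
        definable_map_list_decode[OF H] definable_length_list_decode definable_nth definable_const) auto
  from definable_app2[OF this definable_fst_prod_decode[OF definable_nth] definable_snd_prod_decode[OF definable_nth],
      of 0 1 0]
  have "decidable False UNIV 1 (\<lambda>g xs. T g (fst (prod_decode (xs ! 0))) (snd (prod_decode (xs ! 0))))"
    by simp
  then have "definable False UNIV 1 ?C" by (rule decidable_not)
  moreover have "(\<forall>w. ?C g [w] = 0) \<longleftrightarrow> isomorphism L A B (H g) \<and> inv (H g) = K g" for g
  proof -
    have "(\<forall>w. ?C g [w] = 0) \<longleftrightarrow> (\<forall>i a. T g i a)"
      by (auto, metis prod_encode_inverse fst_conv snd_conv)
    also have "\<dots> \<longleftrightarrow> (\<forall>i xs. T g i (list_encode xs))"
      by (metis list_decode_inverse)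
    also have "\<dots> \<longleftrightarrow> isomorphism L A B (H g) \<and> inv (H g) = K g"
    proof
      assume T: "\<forall>i xs. T g i (list_encode xs)"
      have HK: "H g (K g a) = a" "K g (H g a) = a" for a
        \<comment> \<open>The inverse equations do not mention the symbol, so index 0 will do; every
          \<open>a\<close> is the code of \<open>list_decode a\<close>.\<close>
        using T[rule_format, of 0 "list_decode a"] by (auto simp: T_def)
      have "bij (H g)" using HK by (intro bijI') metis+
      moreover have "H g (fun_int A i xs) = fun_int B i (map (H g) xs)"
        if "i \<in> fun_syms L" "length xs = fun_ar L i" for i xs
        using T[rule_format, of i xs] that FA(3)[of i xs] FB(3)[of i "map (H g) xs"]
        by (simp add: T_def char_fun_def)
      moreover have "rel_int A i xs \<longleftrightarrow> rel_int B i (map (H g) xs)"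
        if "i \<in> rel_syms L" "length xs = rel_ar L i" for i xs
        using T[rule_format, of i xs] that FA(4)[of i xs] FB(4)[of i "map (H g) xs"]
        by (simp add: T_def char_fun_def of_bool_eq_iff)
      moreover have "inv (H g) = K g" using HK by (intro inv_equality) auto
      ultimately show "isomorphism L A B (H g) \<and> inv (H g) = K g"
        unfolding isomorphism_def by blast
    next
      assume iso: "isomorphism L A B (H g) \<and> inv (H g) = K g"
      then have bij: "bij (H g)" and K: "K g = inv (H g)" unfolding isomorphism_def by auto
      have HK: "H g (K g a) = a" "K g (H g a) = a" for a
        using bij unfolding K by (simp_all add: bij_is_surj surj_f_inv_f bij_is_inj)
      show "\<forall>i xs. T g i (list_encode xs)"
        using iso HK FA(3,4) FB(3,4) unfolding T_def isomorphism_def by (simp add: char_fun_def)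
    qed
    finally show ?thesis .
  qed
  ultimately show ?thesis by blast
qed

lemma low_for_punctual_isomorphism_settle_count:
  assumes "\<And>B. computable B \<Longrightarrow> \<exists>k. settle_count Q (B k) < k"
  shows "low_for_punctual_isomorphism (pr_degree (settle_count Q))"
  unfolding low_for_punctual_isomorphism_def
proof (intro allI impI)
  fix L A B
  assume A: "punctual L A" and B: "punctual L B"
  assume "\<exists>h. isomorphism L A B h \<and> pr_le_degree (h \<oplus> inv h) (pr_degree (settle_count Q))"
  then obtain h where h: "isomorphism L A B h" "h \<oplus> inv h \<le>\<^bsub>PR\<^esub> settle_count Q"
    unfolding pr_le_degree_def pr_degree_def using pr_le_trans by blast
  then obtain p where p: "has_arity 1 p" "mu_free p"
    "\<And>x. eval (settle_count Q) p [x] = Some ((h \<oplus> inv h) x)"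
    unfolding pr_le_def by blast
  have P: "definable False UNIV 1 (\<lambda>g xs. the (eval g p [xs ! 0]))"
    by (rule definable_cong[OF definable_eval[OF p(1,2)]]) (auto simp: length_Suc_conv)
  \<comment> \<open>The reduction computes the join: even arguments yield the isomorphism, odd ones
    its inverse.\<close>
  define H where "H g x = the (eval g p [2 * x])" for g x
  define K where "K g x = the (eval g p [Suc (2 * x)])" for g x
  have H: "definable False UNIV 1 (\<lambda>g xs. H g (xs ! 0))"
    unfolding H_def by (intro definable_app[OF P] definable_mult definable_basic) simp
  have K: "definable False UNIV 1 (\<lambda>g xs. K g (xs ! 0))"
    unfolding K_def by (intro definable_app[OF P] definable_Suc definable_mult definable_basic) simp
  obtain C where C: "definable False UNIV 1 C"
    "\<And>g. (\<forall>w. C g [w] = 0) \<longleftrightarrow> isomorphism L A B (H g) \<and> inv (H g) = K g"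
    using ex_isomorphism_test[OF A B H K] by blast
  have "H (settle_count Q) = h" "K (settle_count Q) = inv h"
    unfolding H_def K_def by (auto simp: p(3) join_def fun_eq_iff)
  then have "C (settle_count Q) [w] = 0" for w using C(2)[of "settle_count Q"] h(1) by simp
  \<comment> \<open>If every finite counter were rejected, the resulting computable bound would
    contradict the assumption.\<close>
  then obtain e where "\<And>w. C (bit_count e) [w] = 0"
    using ex_computable_settling_bound[OF C(1)] assms by (metis not_less)
  then have iso: "isomorphism L A B (H (bit_count e))" "inv (H (bit_count e)) = K (bit_count e)"
    using C(2) by blast+
  \<comment> \<open>A finite counter with fixed code is primitive recursive, so substituting it for
    the oracle makes both maps primitive recursive.\<close>
  have e: "definable False UNIV 1 (\<lambda>_ xs. bit_count e (xs ! 0))"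
    by (intro definable_bit_count definable_basic) simp
  have "definable False {g} 1 (\<lambda>_ xs. H g (xs ! 0))" "definable False {g} 1 (\<lambda>_ xs. K g (xs ! 0))" for g
    by (rule definable_cong[OF definable_mono[OF H]], simp)
      (rule definable_cong[OF definable_mono[OF K]], simp)
  from this[of "bit_count e", THEN prim_recursive1I, OF e]
  show "punctually_isomorphic L A B"
    unfolding punctually_isomorphic_def using iso by auto
qed

section \<open>The settling counter of a given c.e. set\<close>

theorem theorem4p1:
  fixes d :: "(nat \<Rightarrow> nat) set"
  assumes "ce_turing_degree d" and "d \<noteq> zero_turing_degree"
  shows "\<exists>f :: nat \<Rightarrow> nat. turing_degree f = d \<and>
           low_for_punctual_isomorphism (pr_degree f)"
proof -
  obtain W where W: "ce_set W" and d: "d = turing_degree (char_fun W)"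
    using assms(1) unfolding ce_turing_degree_def by blast
  have noncomputable: "\<not> computable (char_fun W)"
    using turing_degree_computable assms(2) d by blast
  obtain p where p: "has_arity 1 p" "query_free p" "W = {x. eval (\<lambda>_. 0) p [x] \<noteq> None}"
    using W unfolding ce_set_def by blast
  obtain E where E: "stage_approximation 1 p E"
    using ex_stage_approximation[OF p(1,2)] by blast
  have W_iff: "k \<in> W \<longleftrightarrow> (\<exists>s. E [k] s \<noteq> 0)" for k
    using stage_eval[OF E, of "[k]"] p(3) by (auto simp: gr0_conv_Suc)
  have E_mono: "E [k] t \<noteq> 0" if "s \<le> t" "E [k] s \<noteq> 0" for k s t
    using stage_mono[OF E _ that] that(2) by simp
  have defE: "definable b G n (\<lambda>g xs. E [F g xs] (F' g xs))"
    if "definable b G n F" "definable b G n F'" for b G n F F'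
  proof -
    have "definable b G 2 (\<lambda>_ ys. E (butlast ys) (last ys))"
      using definable_mono[OF stage_definable[OF E]] by (simp add: numeral_2_eq_2)
    from definable_app2[OF this that] show ?thesis by simp
  qed
  \<comment> \<open>Elements outside \<open>W\<close> count as settled from the start, so the
    counter never stalls for good; elements of \<open>W\<close> must wait for their
    enumeration.\<close>
  define Q where "Q k x \<longleftrightarrow> char_fun W k = 0 \<or> E [k] x \<noteq> 0" for k x
  let ?c = "settle_count Q"
  have Q_imp: "E [k] x \<noteq> 0" if k: "k \<in> W" and x: "k < ?c x" for k x
  proof -
    obtain y where "y < x" "Q k y" using settle_count_crossing[OF x] by blast
    then show ?thesis using k E_mono[of y x k] by (auto simp: Q_def char_fun_def)
  qed
  \<comment> \<open>Once the counter has passed \<open>k\<close>, the enumeration up to the current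
    stage already decides whether \<open>k\<close> belongs to \<open>W\<close>.\<close>
  have char_eq: "char_fun W k = of_bool (E [k] x \<noteq> 0)" if "k < ?c x" for k x
  proof -
    have "k \<in> W \<longleftrightarrow> E [k] x \<noteq> 0" using Q_imp[OF _ that] W_iff by metis
    then show ?thesis by (simp add: char_fun_def)
  qed
  have "\<exists>x. \<forall>y\<ge>x. Q k y" for k
  proof (cases "k \<in> W")
    case True
    then obtain s where "E [k] s \<noteq> 0" using W_iff by blast
    then show ?thesis using E_mono unfolding Q_def by blast
  qed (simp add: Q_def char_fun_def)
  then have unbounded: "\<exists>z. k < ?c z" for k
    by (rule settle_count_unbounded)
  \<comment> \<open>The recursion of the counter with \<open>W\<close> as oracle, queried only at
    the current value \<open>r\<close>.\<close>
  have "definable True {char_fun W} 1 (\<lambda>g xs. rec_nat 0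
      (\<lambda>m r. r + of_bool (g r = 0 \<or> \<not> E [r] m = 0)) (xs ! 0))"
    by (intro definable_rec_nat definable_add decidable_disj decidable_not decidable_eq
        definable_query defE definable_basic) auto
  moreover have "rec_nat 0 (\<lambda>m r. r + of_bool (char_fun W r = 0 \<or> \<not> E [r] m = 0)) x = ?c x" for x
    by (induction x) (auto simp: Q_def)
  ultimately have "definable True {char_fun W} 1 (\<lambda>_ xs. ?c (xs ! 0))"
    by (elim definable_cong) auto
  then have c_le: "?c \<le>\<^sub>T char_fun W" unfolding turing_le_iff .
  \<comment> \<open>The first stage at which the counter exceeds \<open>k\<close>. The oracle stays
    a variable so that the search counts as a functional of it.\<close>
  define M where "M g k = (LEAST y. (if k < g y then 0 else 1) = (0::nat))" for g :: "nat \<Rightarrow> nat" and k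
  have M: "k < ?c (M ?c k)" for k
  proof -
    have "\<exists>y. (if k < ?c y then 0 else 1) = (0::nat)" using unbounded by simp
    from LeastI_ex[OF this] show ?thesis unfolding M_def[symmetric] by (simp split: if_splits)
  qed
  have "definable True {?c} 1 (\<lambda>g xs. M g (xs ! 0))"
    unfolding M_def using unbounded
    by (intro definable_Least definable_If decidable_less definable_query definable_basic) auto
  from defE[OF definable_nth this]
  have "decidable True {?c} 1 (\<lambda>g xs. \<not> E [xs ! 0] (M g (xs ! 0)) = 0)"
    by (intro decidable_not decidable_eq definable_const) simp
  then have "definable True {?c} 1 (\<lambda>_ xs. char_fun W (xs ! 0))"
    by (rule definable_cong) (simp add: char_eq[OF M])
  then have "char_fun W \<le>\<^sub>T ?c" unfolding turing_le_iff .
  with c_le have "turing_degree ?c = d" unfolding d by (rule turing_degree_eqI)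
  moreover have "\<exists>k. ?c (B k) < k" if B: "computable B" for B
  proof (rule ccontr)
    assume "\<not> (\<exists>k. ?c (B k) < k)"
    \<comment> \<open>Moving from \<open>k\<close> to \<open>Suc k\<close> turns reaching a value
      into passing it, as \<open>char_eq\<close> requires.\<close>
    then have bound: "k < ?c (B (Suc k))" for k by (metis not_less Suc_le_eq)
    have "definable True {\<lambda>_. 0} 1 (\<lambda>g xs. B (xs ! 0))"
      using B unfolding computable_iff .
    from definable_app[of _ _ "\<lambda>_. B", OF this definable_Suc[OF definable_nth]]
    have "definable True {\<lambda>_. 0} 1 (\<lambda>g xs. B (Suc (xs ! 0)))" by simp
    from defE[OF definable_nth this]
    have "decidable True {\<lambda>_. 0} 1 (\<lambda>g xs. \<not> E [xs ! 0] (B (Suc (xs ! 0))) = 0)"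
      by (intro decidable_not decidable_eq definable_const) simp
    then have "definable True {\<lambda>_. 0} 1 (\<lambda>_ xs. char_fun W (xs ! 0))"
      by (rule definable_cong) (simp add: char_eq[OF bound])
    then show False using noncomputable unfolding computable_iff by simp
  qed
  then have "low_for_punctual_isomorphism (pr_degree ?c)"
    by (rule low_for_punctual_isomorphism_settle_count)
  ultimately show ?thesis by blast
qed

end
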